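(* For every tree $\Upsilon$ there is a $C^\infty$ bump function on $C_0(\Upsilon)$, i.e. a non-zero infinitely Fréchet differentiable function $C_0(\Upsilon)\to\mathbb{R}$ with bounded support.
   Context: A tree is a partially ordered set $(\Upsilon,\preceq)$ such that for each $t\in\Upsilon$ the set $\{s: s\preceq t\}$ is well-ordered by $\preceq$; write $(0,t]=\{s:s\preceq t\}$, $(0,t)=\{s:s\prec t\}$, and let $r(t)$ be the order type of $(0,t)$. Trees are assumed Hausdorff: if $r(t)$ is a limit ordinal and $(0,t)=(0,t')$ then $t=t'$. $\Upsilon$ carries the coarsest topology in which every $(0,t]$ is open and closed. $C_0(\Upsilon)$ is the Banach space of continuous $f:\Upsilon\to\mathbb{R}$ such that $\{t:|f(t)|\ge\epsilon\}$ is compact for all $\epsilon>0$, with the supremum norm. *)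

theory Defs
  imports "HOL-Analysis.Analysis"
begin

definition is_tree :: "('a \<Rightarrow> 'a \<Rightarrow> bool) \<Rightarrow> bool" where
  "is_tree le \<longleftrightarrow>
     (\<forall>x. le x x) \<and>
     (\<forall>x y. le x y \<and> le y x \<longrightarrow> x = y) \<and>
     (\<forall>x y z. le x y \<and> le y z \<longrightarrow> le x z) \<and>
     \<comment> \<open>each (0,t] is well-ordered: every nonempty subset has a least element\<close>
     (\<forall>t S. S \<subseteq> {s. le s t} \<and> S \<noteq> {} \<longrightarrow> (\<exists>m\<in>S. \<forall>s\<in>S. le m s)) \<and>
     \<comment> \<open>Hausdorff: if r(t) is a limit ordinal and (0,t) = (0,t') then t = t'\<close>
     (\<forall>t t'. ({s. le s t \<and> s \<noteq> t} \<noteq> {} \<and>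
              (\<forall>s. le s t \<and> s \<noteq> t \<longrightarrow> (\<exists>s'. le s' t \<and> s' \<noteq> t \<and> le s s' \<and> s \<noteq> s')) \<and>
              {s. le s t \<and> s \<noteq> t} = {s. le s t' \<and> s \<noteq> t'}) \<longrightarrow> t = t')"

definition tree_topology :: "('a \<Rightarrow> 'a \<Rightarrow> bool) \<Rightarrow> 'a topology" where
  "tree_topology le =
     topology_generated_by ({{s. le s t} | t. True} \<union> {- {s. le s t} | t. True})"

definition C0 :: "('a \<Rightarrow> 'a \<Rightarrow> bool) \<Rightarrow> ('a \<Rightarrow> real) set" where
  "C0 le = {f. continuous_map (tree_topology le) euclideanreal f \<and>
               (\<forall>\<epsilon>>0. compactin (tree_topology le) {t. \<bar>f t\<bar> \<ge> \<epsilon>})}"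

definition supnorm :: "('a \<Rightarrow> real) \<Rightarrow> real" where
  "supnorm f = (SUP t. \<bar>f t\<bar>)"

definition bounded_multilinear_on ::
  "('a \<Rightarrow> real) set \<Rightarrow> (('a \<Rightarrow> real) \<Rightarrow> real) \<Rightarrow> nat \<Rightarrow> (('a \<Rightarrow> real) list \<Rightarrow> real) \<Rightarrow> bool" where
  "bounded_multilinear_on X nrm k L \<longleftrightarrow>
     (\<forall>hs i u v a b. hs \<in> lists X \<and> length hs = k \<and> i < k \<and> u \<in> X \<and> v \<in> X \<longrightarrow>
        L (hs[i := (\<lambda>t. a * u t + b * v t)]) = a * L (hs[i := u]) + b * L (hs[i := v])) \<and>
     (\<exists>M. \<forall>hs. hs \<in> lists X \<and> length hs = k \<longrightarrow> \<bar>L hs\<bar> \<le> M * prod_list (map nrm hs))"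

text \<open>F is infinitely Frechet differentiable on the normed space (X, nrm):
  there are maps D k x (the k-th derivative at x, a bounded k-linear form) with
  D 0 x [] = F x, and D (Suc k) x is the Frechet derivative at x of the map
  y \<mapsto> D k y (into the space of bounded k-linear forms with its operator norm).\<close>

definition smooth_on ::
  "('a \<Rightarrow> real) set \<Rightarrow> (('a \<Rightarrow> real) \<Rightarrow> real) \<Rightarrow> (('a \<Rightarrow> real) \<Rightarrow> real) \<Rightarrow> bool" where
  "smooth_on X nrm F \<longleftrightarrow>
     (\<exists>D :: nat \<Rightarrow> ('a \<Rightarrow> real) \<Rightarrow> ('a \<Rightarrow> real) list \<Rightarrow> real.
        (\<forall>x\<in>X. D 0 x [] = F x) \<and>
        (\<forall>k. \<forall>x\<in>X. bounded_multilinear_on X nrm k (D k x)) \<and>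
        (\<forall>k. \<forall>x\<in>X. \<forall>\<epsilon>>0. \<exists>\<delta>>0. \<forall>h\<in>X. nrm h < \<delta> \<longrightarrow>
           (\<forall>hs. hs \<in> lists X \<and> length hs = k \<longrightarrow>
              \<bar>D k (\<lambda>t. x t + h t) hs - D k x hs - D (Suc k) x (hs @ [h])\<bar>
                \<le> \<epsilon> * nrm h * prod_list (map nrm hs))))"

end

theory Submission
  imports Defs "HOL-Computational_Algebra.Polynomial"
begin

text \<open>
  Let \<open>c n\<close> decrease to 0. Say that \<open>f\<close> has an \<open>n\<close>-peak at \<open>t\<close> if \<open>\<bar>f t\<bar> \<ge> 1 - c n / 2\<close> and
  \<open>\<bar>f s\<bar> \<le> 1 - 3 * c n\<close> for all immediate successors \<open>s\<close> of \<open>t\<close>. A smooth factor, depending only on the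
  values of \<open>f\<close> at \<open>t\<close> and its immediate successors, is 0 at \<open>n\<close>-peaks and differs from 1 only if
  \<open>\<bar>f t\<bar> > 1 - c n\<close> and \<open>\<bar>f s\<bar> < 1 - 2 * c n\<close> for all these \<open>s\<close>. The bump is the product of all these
  factors on the open unit ball, and 0 elsewhere.

  Inside the ball the product is locally finite. Only finitely many \<open>n\<close> matter since
  \<open>c n > 1 - supnorm f\<close>; and if a fixed jump \<open>\<bar>f s\<bar> \<le> \<bar>f t\<bar> - \<delta>\<close> to all immediate successors
  occurred at infinitely many \<open>t\<close> in the compact set \<open>\<bar>f\<bar> \<ge> 1 / 2\<close>, these \<open>t\<close> would accumulate at some
  \<open>\<tau>\<close> from below, and then the immediate successors of \<open>t\<close> below \<open>\<tau>\<close> would contradict continuity at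
  \<open>\<tau>\<close>. If \<open>supnorm f = 1\<close>, the compact set \<open>\<bar>f\<bar> = 1\<close> has a maximal element \<open>t\<close>. As \<open>\<bar>f\<bar>\<close> exceeds
  any \<open>\<epsilon> > 0\<close> at only finitely many immediate successors of \<open>t\<close>, its values there stay away from 1, so
  \<open>t\<close> is an \<open>n\<close>-peak for some \<open>n\<close>, with room to spare. Hence the bump vanishes near \<open>f\<close>.
\<close>

section \<open>Smooth plateau functions on the reals\<close>

definition smooth_real :: "(real \<Rightarrow> real) \<Rightarrow> bool" where
  "smooth_real f \<longleftrightarrow> (\<exists>D. D 0 = f \<and> (\<forall>k x. (D k has_real_derivative D (Suc k) x) (at x)))"

text \<open>\<open>flat 1\<close> is the classical smooth, non-analytic function at 0. The
  polynomial in \<open>1 / x\<close> makes the family stable under differentiation.\<close>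

definition flat :: "real poly \<Rightarrow> real \<Rightarrow> real" where
  "flat p x = (if x > 0 then poly p (1 / x) * exp (- (1 / x)) else 0)"

text \<open>The free power \<open>k\<close> absorbs the factor \<open>y\<close> in
  \<open>poly (pCons a p) y = a + y * poly p y\<close>, which lets the induction close.\<close>

lemma poly_times_exp_minus_tendsto_0:
  "((\<lambda>y::real. y ^ k * poly p y * exp (- y)) \<longlongrightarrow> 0) at_top"
proof (induction p arbitrary: k)
  case 0
  then show ?case by simp
next
  case (pCons a p)
  have "((\<lambda>y::real. a * (y ^ k / exp y) + y ^ Suc k * poly p y * exp (- y)) \<longlongrightarrow> a * 0 + 0) at_top"
    by (intro tendsto_intros tendsto_power_div_exp_0 pCons.IH)
  then show ?case
    by (simp add: exp_minus field_simps)
qed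

text \<open>With \<open>y = 1 / x\<close> one has \<open>d/dx = - y^2 d/dy\<close>, so
  \<open>p(y) exp(-y)\<close> turns into \<open>y^2 (p - p')(y) exp(-y)\<close>; the factor
  \<open>[:0, 0, 1:]\<close> is \<open>y^2\<close>. At 0 the right difference quotient is
  \<open>y p(y) exp(-y)\<close> with \<open>y\<close> tending to infinity.\<close>

lemma flat_has_derivative:
  "(flat p has_real_derivative flat ([:0, 0, 1:] * (p - pderiv p)) x) (at x)"
proof -
  consider "x > 0" | "x < 0" | "x = 0" by linarith
  then show ?thesis
  proof cases
    case 1
    have "((\<lambda>x. poly p (1 / x) * exp (- (1 / x))) has_real_derivative
        flat ([:0, 0, 1:] * (p - pderiv p)) x) (at x)"
      using 1 unfolding flat_def
      by (auto intro!: derivative_eq_intros poly_DERIV[THEN DERIV_chain2]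
          simp: field_simps power2_eq_square)
    then show ?thesis
      by (rule has_field_derivative_transform_within_open[of _ _ _ "{0<..}"])
         (use 1 in \<open>auto simp: flat_def\<close>)
  next
    case 2
    have "((\<lambda>x. 0) has_real_derivative flat ([:0, 0, 1:] * (p - pderiv p)) x) (at x)"
      using 2 by (simp add: flat_def)
    then show ?thesis
      by (rule has_field_derivative_transform_within_open[of _ _ _ "{..<0}"])
         (use 2 in \<open>auto simp: flat_def\<close>)
  next
    case 3
    have "((\<lambda>h. flat p h / h) \<longlongrightarrow> 0) (at_right 0)"
    proof -
      have "((\<lambda>h::real. (inverse h) ^ 1 * poly p (inverse h) * exp (- inverse h)) \<longlongrightarrow> 0) (at_right 0)"
        by (rule filterlim_compose[OF poly_times_exp_minus_tendsto_0 filterlim_inverse_at_top_right])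
      then show ?thesis
        by (rule Lim_transform_eventually)
           (auto simp: eventually_at_filter flat_def field_simps)
    qed
    moreover have "((\<lambda>h. flat p h / h) \<longlongrightarrow> 0) (at_left 0)"
      by (rule Lim_transform_eventually[OF tendsto_const])
         (auto simp: eventually_at_filter flat_def)
    ultimately have "((\<lambda>h. flat p h / h) \<longlongrightarrow> 0) (at 0)"
      by (simp add: filterlim_at_split)
    then show ?thesis
      using 3 by (simp add: has_field_derivative_iff flat_def)
  qed
qed

text \<open>An algebra of functions closed under differentiation and large enough to contain the
  plateau function below. Membership yields derivatives of all orders by iteration, without a chain
  rule for general smooth functions.\<close>

inductive flat_alg :: "real poly \<Rightarrow> real \<Rightarrow> (real \<Rightarrow> real) \<Rightarrow> bool" for r c where
  poly: "flat_alg r c (poly q)"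
| flat: "flat_alg r c (\<lambda>x. flat p (poly r x))"
| flat_flat: "flat_alg r c (\<lambda>x. flat p (c - flat 1 (poly r x)))"
| add: "flat_alg r c f \<Longrightarrow> flat_alg r c g \<Longrightarrow> flat_alg r c (\<lambda>x. f x + g x)"
| mult: "flat_alg r c f \<Longrightarrow> flat_alg r c g \<Longrightarrow> flat_alg r c (\<lambda>x. f x * g x)"

lemma flat_alg_derivative:
  assumes "flat_alg r c f"
  shows "\<exists>g. flat_alg r c g \<and> (\<forall>x. (f has_real_derivative g x) (at x))"
  using assms
proof induction
  case (poly q)
  show ?case
    by (rule exI[of _ "poly (pderiv q)"]) (auto intro: flat_alg.intros)
next
  case (flat p)
  show ?case
    by (rule exI[of _ "\<lambda>x. flat ([:0, 0, 1:] * (p - pderiv p)) (poly r x) * poly (pderiv r) x"])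
       (intro conjI allI flat_alg.intros DERIV_chain2[OF flat_has_derivative poly_DERIV])
next
  case (flat_flat p)
  let ?q = "[:0, 0, 1:] * (1 - pderiv 1) :: real poly"
  \<comment> \<open>The inner derivative contributes the constant -1; written as
    \<open>poly [:-1:] x\<close> it is visibly a member of the algebra.\<close>
  let ?g = "\<lambda>x. flat ([:0, 0, 1:] * (p - pderiv p)) (c - flat 1 (poly r x))
      * (poly [:-1:] x * (flat ?q (poly r x) * poly (pderiv r) x))"
  have "((\<lambda>x. flat p (c - flat 1 (poly r x))) has_real_derivative ?g x) (at x)" for x
    by (rule DERIV_chain2[OF flat_has_derivative])
       (auto intro!: derivative_eq_intros DERIV_chain2[OF flat_has_derivative poly_DERIV])
  moreover have "flat_alg r c ?g"
    by (intro flat_alg.intros)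
  ultimately show ?case by blast
next
  case (add f g)
  then obtain f' g' where "flat_alg r c f'" "flat_alg r c g'"
    "\<forall>x. (f has_real_derivative f' x) (at x)" "\<forall>x. (g has_real_derivative g' x) (at x)" by blast
  then show ?case
    by (intro exI[of _ "\<lambda>x. f' x + g' x"]) (auto intro!: flat_alg.intros derivative_intros)
next
  case (mult f g)
  then obtain f' g' where "flat_alg r c f'" "flat_alg r c g'"
    "\<forall>x. (f has_real_derivative f' x) (at x)" "\<forall>x. (g has_real_derivative g' x) (at x)" by blast
  with mult.hyps show ?case
    by (intro exI[of _ "\<lambda>x. f' x * g x + g' x * f x"])
       (auto intro!: flat_alg.intros DERIV_mult)
qed

lemma flat_alg_smooth_real:
  assumes "flat_alg r c f"
  shows "smooth_real f"
proof -
  obtain d where d: "\<And>g. flat_alg r c g \<Longrightarrow> flat_alg r c (d g) \<and> (\<forall>x. (g has_real_derivative d g x) (at x))"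
    using flat_alg_derivative by metis
  have "flat_alg r c ((d ^^ k) f)" for k
    by (induction k) (use assms d in auto)
  then show ?thesis
    unfolding smooth_real_def using d by (intro exI[of _ "\<lambda>k. (d ^^ k) f"]) auto
qed

text \<open>The quadratic \<open>?r\<close> is at most 0 for \<open>\<bar>x\<bar> \<le> p\<close>
  and at least 1 for \<open>\<bar>x\<bar> \<ge> q\<close>. Hence \<open>flat 1 (poly ?r x)\<close>
  is 0 in the first region and at least \<open>?c\<close> in the second, so \<open>?c\<close> minus
  it is mapped by the outer \<open>flat 1\<close> to the constant \<open>flat 1 ?c\<close>,
  respectively to 0. The leading constant normalises the plateau to 1.\<close>

lemma smooth_plateau:
  fixes p q :: real
  assumes "0 \<le> p" "p < q"
  shows "\<exists>w. smooth_real w \<and> (\<forall>x. \<bar>x\<bar> \<le> p \<longrightarrow> w x = 1) \<and> (\<forall>x. \<bar>x\<bar> \<ge> q \<longrightarrow> w x = 0)"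
proof -
  let ?c = "flat 1 1"
  let ?d = "q\<^sup>2 - p\<^sup>2"
  let ?r = "[:- p\<^sup>2 / ?d, 0, 1 / ?d:]"
  let ?w = "\<lambda>x. poly [:1 / flat 1 ?c:] x * flat 1 (?c - flat 1 (poly ?r x))"
  have d: "?d > 0" using assms by (simp add: power_strict_mono)
  have r: "poly ?r x = (\<bar>x\<bar>\<^sup>2 - p\<^sup>2) / ?d" for x
    by (simp add: power2_eq_square diff_divide_distrib)
  have c: "?c > 0" "flat 1 ?c > 0" by (simp_all add: flat_def)
  have "smooth_real ?w"
    by (intro flat_alg_smooth_real[of ?r ?c] flat_alg.intros)
  moreover have "?w x = 1" if "\<bar>x\<bar> \<le> p" for x
  proof -
    have "\<bar>x\<bar>\<^sup>2 \<le> p\<^sup>2" using that by (intro power_mono) auto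
    then have "poly ?r x \<le> 0" unfolding r using d by (simp add: divide_le_0_iff)
    then have "flat 1 (poly ?r x) = 0" by (simp add: flat_def)
    then show ?thesis using c by simp
  qed
  moreover have "?w x = 0" if "\<bar>x\<bar> \<ge> q" for x
  proof -
    have "\<bar>x\<bar>\<^sup>2 \<ge> q\<^sup>2" using that assms by (intro power_mono) auto
    then have "poly ?r x \<ge> 1" unfolding r using d by simp
    then have "flat 1 (poly ?r x) \<ge> ?c" unfolding flat_def by simp
    then show ?thesis by (simp add: flat_def)
  qed
  ultimately show ?thesis by (intro exI[of _ ?w] conjI allI impI)
qed

section \<open>Calculus of smooth functions on function spaces\<close>

text \<open>The body of \<open>smooth_on\<close> with the witness \<open>D\<close> as a parameter,
  so that concrete derivative families can be compared and combined.\<close>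

definition is_derivs ::
  "('a \<Rightarrow> real) set \<Rightarrow> (('a \<Rightarrow> real) \<Rightarrow> real) \<Rightarrow> (nat \<Rightarrow> ('a \<Rightarrow> real) \<Rightarrow> ('a \<Rightarrow> real) list \<Rightarrow> real)
    \<Rightarrow> (('a \<Rightarrow> real) \<Rightarrow> real) \<Rightarrow> bool" where
  "is_derivs X nrm D F \<longleftrightarrow>
        (\<forall>x\<in>X. D 0 x [] = F x) \<and>
        (\<forall>k. \<forall>x\<in>X. bounded_multilinear_on X nrm k (D k x)) \<and>
        (\<forall>k. \<forall>x\<in>X. \<forall>\<epsilon>>0. \<exists>\<delta>>0. \<forall>h\<in>X. nrm h < \<delta> \<longrightarrow>
           (\<forall>hs. hs \<in> lists X \<and> length hs = k \<longrightarrow>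
              \<bar>D k (\<lambda>t. x t + h t) hs - D k x hs - D (Suc k) x (hs @ [h])\<bar>
                \<le> \<epsilon> * nrm h * prod_list (map nrm hs)))"

lemma smooth_on_iff: "smooth_on X nrm F \<longleftrightarrow> (\<exists>D. is_derivs X nrm D F)"
  unfolding smooth_on_def is_derivs_def ..

section \<open>Sublists at complementary sets of positions, for the Leibniz rule\<close>

lemma nths_append_singleton:
  "nths (hs @ [h]) A = nths hs A @ (if length hs \<in> A then [h] else [])"
  by (simp add: nths_append)

lemma nths_cong:
  assumes "\<And>i. i < length xs \<Longrightarrow> i \<in> A \<longleftrightarrow> i \<in> B"
  shows "nths xs A = nths xs B"
  using assms by (induction xs rule: rev_induct) (simp_all add: nths_append_singleton)

text \<open>Recombines the norm bounds of the two Leibniz factors into one bound over all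
  directions.\<close>

lemma prod_list_nths_split:
  fixes f :: "'b \<Rightarrow> 'c::comm_monoid_mult"
  shows "prod_list (map f (nths hs A)) * prod_list (map f (nths hs (- A))) = prod_list (map f hs)"
proof (induction hs rule: rev_induct)
  case (snoc h hs)
  then show ?case
    by (cases "length hs \<in> A") (simp_all add: nths_append_singleton mult.assoc mult.left_commute mult.commute)
qed simp

lemma lists_nths: "hs \<in> lists X \<Longrightarrow> nths hs A \<in> lists X"
  using set_nths_subset[of hs A] by auto

text \<open>The derivatives of a smooth function are iterated directional derivatives (innermost direction
  last); these depend on the function only locally, which allows gluing.\<close>
fun dir_deriv :: "(('a \<Rightarrow> real) \<Rightarrow> real) \<Rightarrow> ('a \<Rightarrow> real) list \<Rightarrow> ('a \<Rightarrow> real) \<Rightarrow> real" where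
  "dir_deriv F [] x = F x"
| "dir_deriv F (h # hs) x = deriv (\<lambda>r. dir_deriv F hs (\<lambda>t. x t + r * h t)) 0"

text \<open>A linear space of functions whose norm dominates all point values, so that every
  evaluation is a bounded linear functional.\<close>

locale normed_fun_space =
  fixes X :: "('a \<Rightarrow> real) set" and nrm :: "('a \<Rightarrow> real) \<Rightarrow> real"
  assumes add_mem: "x \<in> X \<Longrightarrow> y \<in> X \<Longrightarrow> (\<lambda>t. x t + y t) \<in> X"
    and cmult_mem: "x \<in> X \<Longrightarrow> (\<lambda>t. c * x t) \<in> X"
    and abs_le_nrm: "x \<in> X \<Longrightarrow> \<bar>x t\<bar> \<le> nrm x"
    and nrm_cmult: "x \<in> X \<Longrightarrow> nrm (\<lambda>t. c * x t) = \<bar>c\<bar> * nrm x"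
    and nrm_add: "x \<in> X \<Longrightarrow> y \<in> X \<Longrightarrow> nrm (\<lambda>t. x t + y t) \<le> nrm x + nrm y"
begin

section \<open>Elementary properties of derivative families\<close>

lemma nrm_nonneg: "x \<in> X \<Longrightarrow> 0 \<le> nrm x"
  using abs_le_nrm[of x undefined] by linarith

lemma prod_nrm_nonneg: "hs \<in> lists X \<Longrightarrow> 0 \<le> prod_list (map nrm hs)"
  by (induction hs) (auto intro!: mult_nonneg_nonneg nrm_nonneg)

lemma is_derivs_zero: "is_derivs X nrm D F \<Longrightarrow> x \<in> X \<Longrightarrow> D 0 x [] = F x"
  unfolding is_derivs_def by simp

text \<open>The slot is marked by a split of the list rather than by a list update, since splits
  commute well with appending directions and with \<open>nths\<close>.\<close>

lemma is_derivs_linear: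
  assumes "is_derivs X nrm D F" "x \<in> X" "as \<in> lists X" "bs \<in> lists X" "u \<in> X" "v \<in> X"
    and k: "k = Suc (length as + length bs)"
  shows "D k x (as @ (\<lambda>t. a * u t + b * v t) # bs) = a * D k x (as @ u # bs) + b * D k x (as @ v # bs)"
proof -
  have "bounded_multilinear_on X nrm k (D k x)"
    using assms(1,2) unfolding is_derivs_def by simp
  then have "\<forall>hs i u v a b. hs \<in> lists X \<and> length hs = k \<and> i < k \<and> u \<in> X \<and> v \<in> X \<longrightarrow>
        D k x (hs[i := (\<lambda>t. a * u t + b * v t)]) = a * D k x (hs[i := u]) + b * D k x (hs[i := v])"
    unfolding bounded_multilinear_on_def by (rule conjunct1)
  from this[rule_format, of "as @ u # bs" "length as" u v a b] show ?thesis
    using assms(3-6) k by simp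
qed

lemma is_derivs_bound:
  assumes "is_derivs X nrm D F" "x \<in> X"
  shows "\<exists>M\<ge>0. \<forall>hs\<in>lists X. length hs = k \<longrightarrow> \<bar>D k x hs\<bar> \<le> M * prod_list (map nrm hs)"
proof -
  have "bounded_multilinear_on X nrm k (D k x)"
    using assms unfolding is_derivs_def by simp
  then obtain M where M: "\<forall>hs. hs \<in> lists X \<and> length hs = k \<longrightarrow> \<bar>D k x hs\<bar> \<le> M * prod_list (map nrm hs)"
    unfolding bounded_multilinear_on_def by (elim conjE exE)
  have "\<bar>D k x hs\<bar> \<le> \<bar>M\<bar> * prod_list (map nrm hs)" if "hs \<in> lists X" "length hs = k" for hs
    using M[rule_format, of hs] that mult_right_mono[OF abs_ge_self[of M] prod_nrm_nonneg[OF that(1)]]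
    by simp
  then show ?thesis by (intro exI[of _ "\<bar>M\<bar>"]) simp
qed

lemma is_derivs_frechet:
  assumes "is_derivs X nrm D F" "x \<in> X" "\<epsilon> > 0"
  shows "\<exists>\<delta>>0. \<forall>h\<in>X. nrm h < \<delta> \<longrightarrow> (\<forall>hs\<in>lists X. length hs = k \<longrightarrow>
       \<bar>D k (\<lambda>t. x t + h t) hs - D k x hs - D (Suc k) x (hs @ [h])\<bar>
         \<le> \<epsilon> * nrm h * prod_list (map nrm hs))"
proof -
  have "\<exists>\<delta>>0. \<forall>h\<in>X. nrm h < \<delta> \<longrightarrow>
           (\<forall>hs. hs \<in> lists X \<and> length hs = k \<longrightarrow>
              \<bar>D k (\<lambda>t. x t + h t) hs - D k x hs - D (Suc k) x (hs @ [h])\<bar>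
                \<le> \<epsilon> * nrm h * prod_list (map nrm hs))"
    using assms unfolding is_derivs_def by simp
  then show ?thesis by (simp add: Ball_def imp_conjL)
qed

lemma is_derivsI:
  assumes "\<And>x. x \<in> X \<Longrightarrow> D 0 x [] = F x"
    and lin: "\<And>x as bs u v a b. x \<in> X \<Longrightarrow> as \<in> lists X \<Longrightarrow> bs \<in> lists X \<Longrightarrow> u \<in> X \<Longrightarrow> v \<in> X \<Longrightarrow>
      D (Suc (length as + length bs)) x (as @ (\<lambda>t. a * u t + b * v t) # bs)
        = a * D (Suc (length as + length bs)) x (as @ u # bs) + b * D (Suc (length as + length bs)) x (as @ v # bs)"
    and bdd: "\<And>k x. x \<in> X \<Longrightarrow> \<exists>M. \<forall>hs\<in>lists X. length hs = k \<longrightarrow> \<bar>D k x hs\<bar> \<le> M * prod_list (map nrm hs)"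
    and "\<And>k x \<epsilon>. x \<in> X \<Longrightarrow> \<epsilon> > 0 \<Longrightarrow> \<exists>\<delta>>0. \<forall>h\<in>X. nrm h < \<delta> \<longrightarrow> (\<forall>hs\<in>lists X. length hs = k \<longrightarrow>
       \<bar>D k (\<lambda>t. x t + h t) hs - D k x hs - D (Suc k) x (hs @ [h])\<bar>
         \<le> \<epsilon> * nrm h * prod_list (map nrm hs))"
  shows "is_derivs X nrm D F"
proof -
  have "D k x (hs[i := (\<lambda>t. a * u t + b * v t)]) = a * D k x (hs[i := u]) + b * D k x (hs[i := v])"
    if "x \<in> X" "hs \<in> lists X" "length hs = k" "i < k" "u \<in> X" "v \<in> X" for k x hs i u v a b
  proof -
    have "set (take i hs) \<subseteq> X" "set (drop (Suc i) hs) \<subseteq> X"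
      using that(2) set_take_subset[of i hs] set_drop_subset[of "Suc i" hs] by auto
    then have "take i hs \<in> lists X" "drop (Suc i) hs \<in> lists X" by auto
    moreover have "Suc (length (take i hs) + length (drop (Suc i) hs)) = k"
      using that(3,4) by simp
    moreover have "hs[i := w] = take i hs @ w # drop (Suc i) hs" for w
      using that(3,4) by (simp add: upd_conv_take_nth_drop)
    ultimately show ?thesis
      using lin[of x "take i hs" "drop (Suc i) hs" u v a b] that by simp
  qed
  with bdd have "bounded_multilinear_on X nrm k (D k x)" if "x \<in> X" for k x
    unfolding bounded_multilinear_on_def using that by (simp add: Ball_def imp_conjL)
  with assms(1,4) show ?thesis unfolding is_derivs_def by (simp add: Ball_def imp_conjL)
qed

text \<open>The Frechet estimate for the increment \<open>r * h\<close>, divided by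
  \<open>r\<close>.\<close>

lemma deriv_along:
  assumes "is_derivs X nrm D F" "x \<in> X" "h \<in> X" "hs \<in> lists X"
  shows "((\<lambda>r. D (length hs) (\<lambda>t. x t + r * h t) hs) has_real_derivative
           D (Suc (length hs)) x (hs @ [h])) (at 0)"
proof -
  let ?k = "length hs" and ?p = "prod_list (map nrm hs)"
  let ?L = "D (Suc ?k) x (hs @ [h])"
  let ?\<phi> = "\<lambda>r. D ?k (\<lambda>t. x t + r * h t) hs"
  have lin: "D (Suc ?k) x (hs @ [\<lambda>t. r * h t]) = r * ?L" for r
  proof -
    have "D (Suc ?k) x (hs @ (\<lambda>t. r * h t + 0 * h t) # []) = r * ?L + 0 * ?L"
      by (rule is_derivs_linear[OF assms(1,2,4) _ assms(3,3)]) simp_all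
    then show ?thesis by simp
  qed
  have "((\<lambda>r. (?\<phi> (0 + r) - ?\<phi> 0) / r) \<longlongrightarrow> ?L) (at 0)"
    unfolding LIM_def
  proof (intro allI impI)
    fix e :: real assume e: "e > 0"
    \<comment> \<open>The summand 1 keeps \<open>?C\<close> positive even when
      \<open>nrm h * ?p = 0\<close>; the tolerance \<open>e / (2 * ?C)\<close> then leaves a strict
      inequality after multiplication by \<open>nrm h * ?p\<close>.\<close>
    let ?C = "nrm h * ?p + 1"
    have C: "?C > 0" "nrm h * ?p \<ge> 0"
      using nrm_nonneg[OF assms(3)] prod_nrm_nonneg[OF assms(4)]
      by (simp_all add: add_nonneg_pos)
    have "e / (2 * ?C) > 0" using e C by simp
    from is_derivs_frechet[OF assms(1,2) this, of ?k]
    obtain d where d: "d > 0" "\<forall>h\<in>X. nrm h < d \<longrightarrow> (\<forall>hs'\<in>lists X. length hs' = ?k \<longrightarrow>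
        \<bar>D ?k (\<lambda>t. x t + h t) hs' - D ?k x hs' - D (Suc ?k) x (hs' @ [h])\<bar>
          \<le> e / (2 * ?C) * nrm h * prod_list (map nrm hs'))"
      by (elim exE conjE)
    have "dist ((?\<phi> (0 + r) - ?\<phi> 0) / r) ?L < e" if r: "r \<noteq> 0" "dist r 0 < d / (nrm h + 1)" for r
    proof -
      have "\<bar>r\<bar> * (nrm h + 1) < d"
        using r nrm_nonneg[OF assms(3)] by (simp add: field_simps)
      moreover have "\<bar>r\<bar> * nrm h \<le> \<bar>r\<bar> * (nrm h + 1)" by (intro mult_left_mono) auto
      ultimately have "nrm (\<lambda>t. r * h t) < d" using nrm_cmult[OF assms(3)] by simp
      from d(2)[rule_format, OF cmult_mem[OF assms(3)] this assms(4) refl]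
      have "\<bar>?\<phi> r - ?\<phi> 0 - r * ?L\<bar> \<le> e / (2 * ?C) * (\<bar>r\<bar> * nrm h) * ?p"
        by (simp add: lin nrm_cmult[OF assms(3)])
      also have "\<dots> = \<bar>r\<bar> * (e * (nrm h * ?p) / (2 * ?C))" by simp
      also have "\<dots> < \<bar>r\<bar> * e"
      proof (rule mult_strict_left_mono)
        have "e * (nrm h * ?p) < e * (2 * ?C)" using e C by (intro mult_strict_left_mono) auto
        then show "e * (nrm h * ?p) / (2 * ?C) < e" using C by (simp add: pos_divide_less_eq)
      qed (use r in auto)
      finally have "\<bar>?\<phi> r - ?\<phi> 0 - r * ?L\<bar> < \<bar>r\<bar> * e" .
      moreover have "(?\<phi> (0 + r) - ?\<phi> 0) / r - ?L = (?\<phi> r - ?\<phi> 0 - r * ?L) / r"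
        using r by (simp add: field_simps)
      ultimately show ?thesis using r by (simp add: dist_real_def field_simps)
    qed
    then show "\<exists>s>0. \<forall>r. r \<noteq> 0 \<and> dist r 0 < s \<longrightarrow> dist ((?\<phi> (0 + r) - ?\<phi> 0) / r) ?L < e"
      using d(1) nrm_nonneg[OF assms(3)] by (intro exI[of _ "d / (nrm h + 1)"]) auto
  qed
  then show ?thesis unfolding DERIV_def .
qed

text \<open>Derivative families are therefore determined by \<open>F\<close> on \<open>X\<close>.
  The list is reversed because \<open>D\<close> appends the newest direction at the end, whereas
  \<open>dir_deriv\<close> puts it in front.\<close>

lemma is_derivs_eq_dir_deriv:
  assumes "is_derivs X nrm D F" "x \<in> X" "hs \<in> lists X"
  shows "D (length hs) x hs = dir_deriv F (rev hs) x"
  using assms(2,3)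
proof (induction hs arbitrary: x rule: rev_induct)
  case Nil
  then show ?case using is_derivs_zero[OF assms(1)] by simp
next
  case (snoc h hs)
  then have h: "h \<in> X" "hs \<in> lists X" by auto
  have "dir_deriv F (rev (hs @ [h])) x = deriv (\<lambda>r. D (length hs) (\<lambda>t. x t + r * h t) hs) 0"
    using snoc.IH[OF add_mem[OF snoc.prems(1) cmult_mem[OF h(1)]] h(2)] by simp
  also have "\<dots> = D (Suc (length hs)) x (hs @ [h])"
    by (rule DERIV_imp_deriv[OF deriv_along[OF assms(1) snoc.prems(1) h]])
  finally show ?case by simp
qed

text \<open>Agreement at \<open>x\<close> alone would not survive a differentiation, so the
  induction carries agreement at every point of the open ball.\<close>

lemma dir_deriv_local:
  assumes "\<rho> > 0" "\<And>g. g \<in> X \<Longrightarrow> nrm g < \<rho> \<Longrightarrow> F (\<lambda>t. x t + g t) = G (\<lambda>t. x t + g t)"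
    "g \<in> X" "nrm g < \<rho>" "hs \<in> lists X"
  shows "dir_deriv F hs (\<lambda>t. x t + g t) = dir_deriv G hs (\<lambda>t. x t + g t)"
  using assms(3-5)
proof (induction hs arbitrary: g)
  case Nil
  then show ?case using assms(2) by simp
next
  case (Cons h hs)
  then have h: "h \<in> X" "hs \<in> lists X" by auto
  \<comment> \<open>For \<open>\<bar>r\<bar> < ?e\<close> the displacement \<open>g + r * h\<close>
    stays in the ball; the 1 in the denominator covers \<open>nrm h = 0\<close>.\<close>
  let ?e = "(\<rho> - nrm g) / (nrm h + 1)"
  have e: "?e > 0" using Cons.prems(2) nrm_nonneg[OF h(1)] by simp
  have "dir_deriv F hs (\<lambda>t. (x t + g t) + r * h t) = dir_deriv G hs (\<lambda>t. (x t + g t) + r * h t)"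
    if "\<bar>r\<bar> < ?e" for r
  proof -
    have "\<bar>r\<bar> * (nrm h + 1) < \<rho> - nrm g"
      using that nrm_nonneg[OF h(1)] by (simp add: field_simps)
    moreover have "\<bar>r\<bar> * nrm h \<le> \<bar>r\<bar> * (nrm h + 1)" by (intro mult_left_mono) auto
    ultimately have "nrm (\<lambda>t. g t + r * h t) < \<rho>"
      using nrm_add[OF Cons.prems(1) cmult_mem[OF h(1)], of r] nrm_cmult[OF h(1), of r] by simp
    from Cons.IH[OF add_mem[OF Cons.prems(1) cmult_mem[OF h(1)]] this h(2)]
    show ?thesis by (simp add: add.assoc)
  qed
  then have "\<forall>\<^sub>F r in nhds 0. dir_deriv F hs (\<lambda>t. (x t + g t) + r * h t)
      = dir_deriv G hs (\<lambda>t. (x t + g t) + r * h t)"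
    using e unfolding eventually_nhds_metric by (auto simp: dist_real_def)
  then show ?case by (simp add: deriv_cong_ev)
qed

text \<open>The candidate derivatives are the directional derivatives of \<open>F\<close> itself, so
  nothing has to be glued. Near each point they coincide with the derivative family of the local
  model \<open>G\<close>, from which all required estimates are inherited.\<close>

lemma smooth_on_local:
  assumes "\<And>x. x \<in> X \<Longrightarrow> \<exists>G \<rho>. \<rho> > 0 \<and> smooth_on X nrm G \<and>
      (\<forall>h\<in>X. nrm h < \<rho> \<longrightarrow> F (\<lambda>t. x t + h t) = G (\<lambda>t. x t + h t))"
  shows "smooth_on X nrm F"
  unfolding smooth_on_iff
proof (intro exI)
  let ?D = "\<lambda>k x hs. dir_deriv F (rev hs) x"
  have zero: "(\<lambda>t. 0) \<in> X" "nrm (\<lambda>t. 0) = 0" if "x \<in> X" for x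
    using cmult_mem[OF that, of 0] nrm_cmult[OF that, of 0] by auto
  have loc: "\<exists>D \<rho>. \<rho> > 0 \<and> (\<exists>G. is_derivs X nrm D G) \<and> (\<forall>h\<in>X. nrm h < \<rho> \<longrightarrow> (\<forall>hs\<in>lists X.
      dir_deriv F (rev hs) (\<lambda>t. x t + h t) = D (length hs) (\<lambda>t. x t + h t) hs))" if x: "x \<in> X" for x
  proof -
    obtain G \<rho> D where G: "\<rho> > 0" "is_derivs X nrm D G"
      "\<And>h. h \<in> X \<Longrightarrow> nrm h < \<rho> \<Longrightarrow> F (\<lambda>t. x t + h t) = G (\<lambda>t. x t + h t)"
      using assms[OF x] unfolding smooth_on_iff by blast
    have "dir_deriv F (rev hs) (\<lambda>t. x t + h t) = D (length hs) (\<lambda>t. x t + h t) hs"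
      if "h \<in> X" "nrm h < \<rho>" "hs \<in> lists X" for h hs
    proof -
      have "rev hs \<in> lists X" using that(3) by auto
      from dir_deriv_local[of \<rho> F x G, OF G(1) G(3) that(1,2) this]
      show ?thesis using is_derivs_eq_dir_deriv[OF G(2) add_mem[OF x that(1)] that(3)] by simp
    qed
    with G show ?thesis by blast
  qed
  \<comment> \<open>The centre is the case \<open>h = 0\<close> of the local agreement.\<close>
  have D0: "dir_deriv F (rev hs) x = D (length hs) x hs"
    if "x \<in> X" "\<rho> > 0" "\<forall>h\<in>X. nrm h < \<rho> \<longrightarrow> (\<forall>hs\<in>lists X.
      dir_deriv F (rev hs) (\<lambda>t. x t + h t) = D (length hs) (\<lambda>t. x t + h t) hs)" "hs \<in> lists X" for x \<rho> D hs
    using that(3)[rule_format, of "\<lambda>t. 0" hs] zero[OF that(1)] that(2,4) by simp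
  show "is_derivs X nrm ?D F"
  proof (rule is_derivsI)
    fix x as bs u v a b assume x: "x \<in> X" and l: "as \<in> lists X" "bs \<in> lists X" "u \<in> X" "v \<in> X"
    obtain D \<rho> G where D: "\<rho> > 0" "is_derivs X nrm D G" "\<forall>h\<in>X. nrm h < \<rho> \<longrightarrow> (\<forall>hs\<in>lists X.
        dir_deriv F (rev hs) (\<lambda>t. x t + h t) = D (length hs) (\<lambda>t. x t + h t) hs)"
      using loc[OF x] by (elim exE conjE)
    have "w \<in> X \<Longrightarrow> dir_deriv F (rev (as @ w # bs)) x = D (Suc (length as + length bs)) x (as @ w # bs)" for w
      using D0[of x \<rho> D, OF x D(1,3), of "as @ w # bs"] l by simp
    moreover have "(\<lambda>t. a * u t + b * v t) \<in> X"
      by (intro add_mem cmult_mem l)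
    ultimately show "dir_deriv F (rev (as @ (\<lambda>t. a * u t + b * v t) # bs)) x
        = a * dir_deriv F (rev (as @ u # bs)) x + b * dir_deriv F (rev (as @ v # bs)) x"
      using is_derivs_linear[OF D(2) x l refl, of a b] l by (simp del: rev_append rev.simps)
  next
    fix k x assume x: "x \<in> X"
    obtain D \<rho> G where D: "\<rho> > 0" "is_derivs X nrm D G" "\<forall>h\<in>X. nrm h < \<rho> \<longrightarrow> (\<forall>hs\<in>lists X.
        dir_deriv F (rev hs) (\<lambda>t. x t + h t) = D (length hs) (\<lambda>t. x t + h t) hs)"
      using loc[OF x] by (elim exE conjE)
    obtain M where "M \<ge> 0" "\<forall>hs\<in>lists X. length hs = k \<longrightarrow> \<bar>D k x hs\<bar> \<le> M * prod_list (map nrm hs)"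
      using is_derivs_bound[OF D(2) x, of k] by (elim exE conjE)
    then have "\<forall>hs\<in>lists X. length hs = k \<longrightarrow> \<bar>?D k x hs\<bar> \<le> M * prod_list (map nrm hs)"
      using D0[of x \<rho> D, OF x D(1,3)] by simp
    then show "\<exists>M. \<forall>hs\<in>lists X. length hs = k \<longrightarrow> \<bar>?D k x hs\<bar> \<le> M * prod_list (map nrm hs)" ..
  next
    fix k x \<epsilon> assume x: "x \<in> X" and "(\<epsilon>::real) > 0"
    obtain D \<rho> G where D: "\<rho> > 0" "is_derivs X nrm D G" "\<forall>h\<in>X. nrm h < \<rho> \<longrightarrow> (\<forall>hs\<in>lists X.
        dir_deriv F (rev hs) (\<lambda>t. x t + h t) = D (length hs) (\<lambda>t. x t + h t) hs)"
      using loc[OF x] by (elim exE conjE)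
    obtain \<delta> where \<delta>: "\<delta> > 0" "\<forall>h\<in>X. nrm h < \<delta> \<longrightarrow> (\<forall>hs\<in>lists X. length hs = k \<longrightarrow>
       \<bar>D k (\<lambda>t. x t + h t) hs - D k x hs - D (Suc k) x (hs @ [h])\<bar>
                \<le> \<epsilon> * nrm h * prod_list (map nrm hs))"
      using is_derivs_frechet[OF D(2) x \<open>\<epsilon> > 0\<close>, of k] by (elim exE conjE)
    have "\<bar>?D k (\<lambda>t. x t + h t) hs - ?D k x hs - ?D (Suc k) x (hs @ [h])\<bar>
                \<le> \<epsilon> * nrm h * prod_list (map nrm hs)"
      if "h \<in> X" "nrm h < min \<delta> \<rho>" "hs \<in> lists X" "length hs = k" for h hs
      using \<delta>(2)[rule_format, OF that(1) _ that(3,4)] D(3)[rule_format, OF that(1) _ that(3)] D0[of x \<rho> D, OF x D(1,3) that(3)]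
        D0[of x \<rho> D, OF x D(1,3), of "hs @ [h]"] that by simp
    then show "\<exists>\<delta>>0. \<forall>h\<in>X. nrm h < \<delta> \<longrightarrow> (\<forall>hs\<in>lists X. length hs = k \<longrightarrow>
        \<bar>?D k (\<lambda>t. x t + h t) hs - ?D k x hs - ?D (Suc k) x (hs @ [h])\<bar>
                \<le> \<epsilon> * nrm h * prod_list (map nrm hs))"
      using \<delta>(1) D(1) by (intro exI[of _ "min \<delta> \<rho>"]) simp
  qed simp
qed

section \<open>Constants, evaluations, sums and products of smooth functions\<close>

lemma smooth_on_const: "smooth_on X nrm (\<lambda>x. c)"
  unfolding smooth_on_iff
proof (intro exI)
  show "is_derivs X nrm (\<lambda>k x hs. if k = 0 then c else 0) (\<lambda>x. c)"
  proof (rule is_derivsI)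
    show "\<exists>M. \<forall>hs\<in>lists X. length hs = k \<longrightarrow> \<bar>if k = 0 then c else 0\<bar> \<le> M * prod_list (map nrm hs)" for k
      by (rule exI[of _ "\<bar>c\<bar>"]) (auto intro: mult_nonneg_nonneg prod_nrm_nonneg)
    show "\<exists>\<delta>>0. \<forall>h\<in>X. nrm h < \<delta> \<longrightarrow> (\<forall>hs\<in>lists X. length hs = k \<longrightarrow>
        \<bar>(if k = 0 then c else 0) - (if k = 0 then c else 0) - (if Suc k = 0 then c else 0)\<bar>
                \<le> \<epsilon> * nrm h * prod_list (map nrm hs))" if "\<epsilon> > 0" for k and \<epsilon> :: real
      by (rule exI[of _ 1]) (use that in \<open>auto intro!: mult_nonneg_nonneg nrm_nonneg prod_nrm_nonneg\<close>)
  qed simp_all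
qed

text \<open>Evaluation at \<open>t\<close> is linear, so the \<open>k\<close>-th derivative is the
  \<open>k\<close>-th real derivative of \<open>\<phi>\<close> at \<open>x t\<close> times the
  product of the values \<open>h t\<close>. As \<open>\<bar>h t\<bar> \<le> nrm h\<close>, the real
  remainder estimate carries over uniformly in the directions.\<close>

lemma smooth_on_eval:
  assumes "smooth_real \<phi>"
  shows "smooth_on X nrm (\<lambda>x. \<phi> (x t))"
proof -
  obtain d where d: "d 0 = \<phi>" "\<And>k x. (d k has_real_derivative d (Suc k) x) (at x)"
    using assms unfolding smooth_real_def by blast
  let ?e = "\<lambda>hs. prod_list (map (\<lambda>h. h t) hs)"
  have e_le: "\<bar>?e hs\<bar> \<le> prod_list (map nrm hs)" if "hs \<in> lists X" for hs
    using that
  proof (induction hs)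
    case (Cons h hs)
    then show ?case by (auto simp: abs_mult intro!: mult_mono abs_le_nrm nrm_nonneg)
  qed simp
  let ?D = "\<lambda>k x hs. d k (x t) * ?e hs"
  have "is_derivs X nrm ?D (\<lambda>x. \<phi> (x t))"
  proof (rule is_derivsI)
    fix k x
    show "\<exists>M. \<forall>hs\<in>lists X. length hs = k \<longrightarrow> \<bar>?D k x hs\<bar> \<le> M * prod_list (map nrm hs)"
      by (rule exI[of _ "\<bar>d k (x t)\<bar>"]) (use e_le in \<open>simp add: abs_mult mult_left_mono\<close>)
    fix \<epsilon> :: real assume \<epsilon>: "\<epsilon> > 0"
    have "(d k has_derivative (*) (d (Suc k) (x t))) (at (x t))"
      using d(2) by (simp add: has_field_derivative_def)
    then obtain \<delta> where \<delta>: "\<delta> > 0" "\<And>y. \<bar>y - x t\<bar> < \<delta> \<Longrightarrow>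
        \<bar>d k y - d k (x t) - d (Suc k) (x t) * (y - x t)\<bar> \<le> \<epsilon> * \<bar>y - x t\<bar>"
      using \<epsilon> unfolding has_derivative_within_alt by (auto simp: mult.commute)
    have "\<bar>?D k (\<lambda>t. x t + h t) hs - ?D k x hs - ?D (Suc k) x (hs @ [h])\<bar>
                \<le> \<epsilon> * nrm h * prod_list (map nrm hs)" if h: "h \<in> X" "nrm h < \<delta>" "hs \<in> lists X" for h hs
    proof -
      have "\<bar>h t\<bar> < \<delta>" using abs_le_nrm[OF h(1), of t] h(2) by linarith
      then have "\<bar>d k (x t + h t) - d k (x t) - d (Suc k) (x t) * h t\<bar> \<le> \<epsilon> * \<bar>h t\<bar>"
        using \<delta>(2)[of "x t + h t"] by simp
      also have "\<dots> \<le> \<epsilon> * nrm h" using \<epsilon> abs_le_nrm[OF h(1)] by simp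
      finally have "\<bar>d k (x t + h t) - d k (x t) - d (Suc k) (x t) * h t\<bar> * \<bar>?e hs\<bar>
        \<le> (\<epsilon> * nrm h) * prod_list (map nrm hs)"
        using e_le[OF h(3)] \<epsilon> nrm_nonneg[OF h(1)] by (intro mult_mono) auto
      then show ?thesis by (simp add: abs_mult[symmetric] algebra_simps)
    qed
    then show "\<exists>\<delta>>0. \<forall>h\<in>X. nrm h < \<delta> \<longrightarrow> (\<forall>hs\<in>lists X. length hs = k \<longrightarrow>
        \<bar>?D k (\<lambda>t. x t + h t) hs - ?D k x hs - ?D (Suc k) x (hs @ [h])\<bar>
                \<le> \<epsilon> * nrm h * prod_list (map nrm hs))"
      using \<delta>(1) by (intro exI[of _ \<delta>]) simp
  qed (simp_all add: d(1) algebra_simps)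
  then show ?thesis unfolding smooth_on_iff by blast
qed

lemma smooth_on_add:
  assumes "smooth_on X nrm F" "smooth_on X nrm G"
  shows "smooth_on X nrm (\<lambda>x. F x + G x)"
proof -
  obtain D E where D: "is_derivs X nrm D F" and E: "is_derivs X nrm E G"
    using assms unfolding smooth_on_iff by (elim exE)
  let ?D = "\<lambda>k x hs. D k x hs + E k x hs"
  have "is_derivs X nrm ?D (\<lambda>x. F x + G x)"
  proof (rule is_derivsI)
    show "?D 0 x [] = F x + G x" if "x \<in> X" for x
      using is_derivs_zero[OF D that] is_derivs_zero[OF E that] by simp
    show "?D (Suc (length as + length bs)) x (as @ (\<lambda>t. a * u t + b * v t) # bs)
        = a * ?D (Suc (length as + length bs)) x (as @ u # bs) + b * ?D (Suc (length as + length bs)) x (as @ v # bs)"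
      if "x \<in> X" "as \<in> lists X" "bs \<in> lists X" "u \<in> X" "v \<in> X" for x as bs u v a b
      using is_derivs_linear[OF D that refl, of a b] is_derivs_linear[OF E that refl, of a b]
      by (simp add: distrib_left)
  next
    fix k x assume x: "x \<in> X"
    obtain M where M: "M \<ge> 0" "\<forall>hs\<in>lists X. length hs = k \<longrightarrow> \<bar>D k x hs\<bar> \<le> M * prod_list (map nrm hs)"
      using is_derivs_bound[OF D x, of k] by (elim exE conjE)
    obtain N where N: "N \<ge> 0" "\<forall>hs\<in>lists X. length hs = k \<longrightarrow> \<bar>E k x hs\<bar> \<le> N * prod_list (map nrm hs)"
      using is_derivs_bound[OF E x, of k] by (elim exE conjE)
    have "\<bar>?D k x hs\<bar> \<le> (M + N) * prod_list (map nrm hs)" if "hs \<in> lists X" "length hs = k" for hs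
      using M(2)[rule_format, OF that] N(2)[rule_format, OF that] by (simp add: distrib_right)
    then show "\<exists>M. \<forall>hs\<in>lists X. length hs = k \<longrightarrow> \<bar>?D k x hs\<bar> \<le> M * prod_list (map nrm hs)"
      by (intro exI[of _ "M + N"]) simp
    fix \<epsilon> :: real assume "\<epsilon> > 0"
    then have e: "\<epsilon> / 2 > 0" by simp
    obtain \<delta>1 where \<delta>1: "\<delta>1 > 0" "\<forall>h\<in>X. nrm h < \<delta>1 \<longrightarrow> (\<forall>hs\<in>lists X. length hs = k \<longrightarrow>
       \<bar>D k (\<lambda>t. x t + h t) hs - D k x hs - D (Suc k) x (hs @ [h])\<bar>
                \<le> \<epsilon> / 2 * nrm h * prod_list (map nrm hs))"
      using is_derivs_frechet[OF D x e, of k] by (elim exE conjE)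
    obtain \<delta>2 where \<delta>2: "\<delta>2 > 0" "\<forall>h\<in>X. nrm h < \<delta>2 \<longrightarrow> (\<forall>hs\<in>lists X. length hs = k \<longrightarrow>
       \<bar>E k (\<lambda>t. x t + h t) hs - E k x hs - E (Suc k) x (hs @ [h])\<bar>
                \<le> \<epsilon> / 2 * nrm h * prod_list (map nrm hs))"
      using is_derivs_frechet[OF E x e, of k] by (elim exE conjE)
    have "\<bar>?D k (\<lambda>t. x t + h t) hs - ?D k x hs - ?D (Suc k) x (hs @ [h])\<bar>
        \<le> \<epsilon> * nrm h * prod_list (map nrm hs)"
      if "h \<in> X" "nrm h < min \<delta>1 \<delta>2" "hs \<in> lists X" "length hs = k" for h hs
    proof -
      have "\<bar>D k (\<lambda>t. x t + h t) hs - D k x hs - D (Suc k) x (hs @ [h])\<bar> \<le> \<epsilon> * nrm h * prod_list (map nrm hs) / 2"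
        "\<bar>E k (\<lambda>t. x t + h t) hs - E k x hs - E (Suc k) x (hs @ [h])\<bar> \<le> \<epsilon> * nrm h * prod_list (map nrm hs) / 2"
        using \<delta>1(2)[rule_format, OF that(1) _ that(3,4)] \<delta>2(2)[rule_format, OF that(1) _ that(3,4)] that(2) by simp_all
      then show ?thesis by linarith
    qed
    then show "\<exists>\<delta>>0. \<forall>h\<in>X. nrm h < \<delta> \<longrightarrow> (\<forall>hs\<in>lists X. length hs = k \<longrightarrow>
        \<bar>?D k (\<lambda>t. x t + h t) hs - ?D k x hs - ?D (Suc k) x (hs @ [h])\<bar>
        \<le> \<epsilon> * nrm h * prod_list (map nrm hs))"
      using \<delta>1(1) \<delta>2(1) by (intro exI[of _ "min \<delta>1 \<delta>2"]) simp
  qed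
  then show ?thesis unfolding smooth_on_iff by (rule exI[of _ ?D])
qed

lemma smooth_on_mult:
  assumes "smooth_on X nrm F" "smooth_on X nrm G"
  shows "smooth_on X nrm (\<lambda>x. F x * G x)"
proof -
  obtain D E where D: "is_derivs X nrm D F" and E: "is_derivs X nrm E G"
    using assms unfolding smooth_on_iff by (elim exE)
  let ?p = "\<lambda>hs. prod_list (map nrm hs)"
  let ?d = "\<lambda>x hs. D (length hs) x hs" and ?e = "\<lambda>x hs. E (length hs) x hs"
  \<comment> \<open>Leibniz rule: \<open>A\<close> is the set of positions of the directions in which \<open>F\<close> is differentiated.\<close>
  let ?t = "\<lambda>x hs A. ?d x (nths hs A) * ?e x (nths hs (- A))"
  let ?L = "\<lambda>(k::nat) x hs. \<Sum>A\<in>Pow {..<length hs}. ?t x hs A"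
  have len: "length (nths hs A) = card A" "length (nths hs (- A)) = length hs - card A"
    if "A \<subseteq> {..<length hs}" for hs :: "('a \<Rightarrow> real) list" and A
  proof -
    have "{i. i < length hs \<and> i \<in> A} = A" "{i. i < length hs \<and> i \<in> - A} = {..<length hs} - A"
      using that by auto
    then show "length (nths hs A) = card A" "length (nths hs (- A)) = length hs - card A"
      using that by (simp_all add: length_nths card_Diff_subset finite_subset[OF that])
  qed
  \<comment> \<open>A set of positions of \<open>hs @ [h]\<close> omits or contains the last one.
    Pairing \<open>A\<close> with \<open>insert ?n A\<close> turns the Leibniz sum into a sum of
    product rules in direction \<open>h\<close>.\<close>
  have step: "?L k x (hs @ [h]) = (\<Sum>A\<in>Pow {..<length hs}. ?d x (nths hs A @ [h]) * ?e x (nths hs (- A))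
      + ?d x (nths hs A) * ?e x (nths hs (- A) @ [h]))" for k :: nat and x hs h
  proof -
    let ?n = "length hs" and ?P = "Pow {..<length hs}"
    have P: "Pow {..<length (hs @ [h])} = ?P \<union> insert ?n ` ?P"
      by (simp add: lessThan_Suc Pow_insert)
    have inj: "inj_on (insert ?n) ?P"
      by (rule inj_on_inverseI[of _ "\<lambda>A. A - {?n}"]) auto
    have disj: "?P \<inter> insert ?n ` ?P = {}" by auto
    have n: "nths hs (insert ?n A) = nths hs A" "nths hs (- insert ?n A) = nths hs (- A)" for A
      by (rule nths_cong; auto)+
    have out: "?t x (hs @ [h]) A = ?d x (nths hs A) * ?e x (nths hs (- A) @ [h])" if "A \<in> ?P" for A
      using that by (auto simp: nths_append_singleton)
    have inn: "?t x (hs @ [h]) (insert ?n A) = ?d x (nths hs A @ [h]) * ?e x (nths hs (- A))" if "A \<in> ?P" for A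
      using that by (simp add: nths_append_singleton n)
    have "?L k x (hs @ [h]) = sum (?t x (hs @ [h])) ?P + sum (?t x (hs @ [h])) (insert ?n ` ?P)"
      unfolding P by (rule sum.union_disjoint) (use disj in auto)
    also have "sum (?t x (hs @ [h])) (insert ?n ` ?P) = (\<Sum>A\<in>?P. ?t x (hs @ [h]) (insert ?n A))"
      using sum.reindex[OF inj] by simp
    finally show ?thesis
      using out inn by (simp add: sum.distrib add.commute)
  qed
  have "is_derivs X nrm ?L (\<lambda>x. F x * G x)"
  proof (rule is_derivsI)
    show "?L 0 x [] = F x * G x" if "x \<in> X" for x
      using is_derivs_zero[OF D that] is_derivs_zero[OF E that] by simp
  next
    fix x as bs u v a b
    assume x: "x \<in> X" and l: "as \<in> lists X" "bs \<in> lists X" "u \<in> X" "v \<in> X"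
    let ?w = "\<lambda>t. a * u t + b * v t"
    have "?t x (as @ ?w # bs) A = a * ?t x (as @ u # bs) A + b * ?t x (as @ v # bs) A" for A
    proof -
      let ?B = "{j. Suc (j + length as) \<in> A}"
      have B: "nths (as @ w # bs) A = nths as A @ (if length as \<in> A then [w] else []) @ nths bs ?B"
        "nths (as @ w # bs) (- A) = nths as (- A) @ (if length as \<in> A then [] else [w]) @ nths bs (- ?B)" for w
        by (simp_all add: nths_append nths_Cons Compl_eq)
      have l': "nths as A \<in> lists X" "nths bs ?B \<in> lists X" "nths as (- A) \<in> lists X" "nths bs (- ?B) \<in> lists X"
        using l(1,2) by (simp_all only: lists_nths)
      show ?thesis
        using is_derivs_linear[OF D x l'(1,2) l(3,4) refl, of a b]
          is_derivs_linear[OF E x l'(3,4) l(3,4) refl, of a b]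
        unfolding B by (cases "length as \<in> A") (simp_all add: algebra_simps)
    qed
    then show "?L (Suc (length as + length bs)) x (as @ ?w # bs)
      = a * ?L (Suc (length as + length bs)) x (as @ u # bs) + b * ?L (Suc (length as + length bs)) x (as @ v # bs)"
      by (simp add: sum.distrib sum_distrib_left)
  next
    fix k x assume x: "x \<in> X"
    have "\<forall>k. \<exists>M. M \<ge> 0 \<and> (\<forall>hs\<in>lists X. length hs = k \<longrightarrow> \<bar>D k x hs\<bar> \<le> M * ?p hs)"
      using is_derivs_bound[OF D x] by simp
    from choice[OF this] obtain M where M':
      "\<forall>k. M k \<ge> 0 \<and> (\<forall>hs\<in>lists X. length hs = k \<longrightarrow> \<bar>D k x hs\<bar> \<le> M k * ?p hs)"
      by (elim exE)
    have M: "M k \<ge> 0" "hs \<in> lists X \<Longrightarrow> \<bar>?d x hs\<bar> \<le> M (length hs) * ?p hs" for k hs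
      using M' by simp_all
    have "\<forall>k. \<exists>M. M \<ge> 0 \<and> (\<forall>hs\<in>lists X. length hs = k \<longrightarrow> \<bar>E k x hs\<bar> \<le> M * ?p hs)"
      using is_derivs_bound[OF E x] by simp
    from choice[OF this] obtain N where N':
      "\<forall>k. N k \<ge> 0 \<and> (\<forall>hs\<in>lists X. length hs = k \<longrightarrow> \<bar>E k x hs\<bar> \<le> N k * ?p hs)"
      by (elim exE)
    have N: "N k \<ge> 0" "hs \<in> lists X \<Longrightarrow> \<bar>?e x hs\<bar> \<le> N (length hs) * ?p hs" for k hs
      using N' by simp_all
    have t_le: "\<bar>?t x hs A\<bar> \<le> M (card A) * N (k - card A) * ?p hs"
      if "hs \<in> lists X" "length hs = k" "A \<in> Pow {..<k}" for hs A
    proof -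
      note l = lists_nths[OF that(1), of A] lists_nths[OF that(1), of "- A"]
      have "\<bar>?t x hs A\<bar> \<le> (M (card A) * ?p (nths hs A)) * (N (k - card A) * ?p (nths hs (- A)))"
        using M(2)[OF l(1)] N(2)[OF l(2)] len[of A hs] that M(1) prod_nrm_nonneg[OF l(1)]
        by (auto simp: abs_mult intro!: mult_mono)
      also have "\<dots> = M (card A) * N (k - card A) * (?p (nths hs A) * ?p (nths hs (- A)))" by simp
      finally show ?thesis by (simp only: prod_list_nths_split)
    qed
    have "\<bar>?L k x hs\<bar> \<le> (\<Sum>A\<in>Pow {..<k}. M (card A) * N (k - card A)) * ?p hs"
      if "hs \<in> lists X" "length hs = k" for hs
    proof -
      have "\<bar>?L k x hs\<bar> \<le> (\<Sum>A\<in>Pow {..<k}. \<bar>?t x hs A\<bar>)"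
        unfolding that(2) by (rule sum_abs)
      also have "\<dots> \<le> (\<Sum>A\<in>Pow {..<k}. M (card A) * N (k - card A) * ?p hs)"
        by (rule sum_mono) (rule t_le[OF that])
      finally show ?thesis by (simp add: sum_distrib_right)
    qed
    then show "\<exists>M. \<forall>hs\<in>lists X. length hs = k \<longrightarrow> \<bar>?L k x hs\<bar> \<le> M * ?p hs"
      by (intro exI[of _ "\<Sum>A\<in>Pow {..<k}. M (card A) * N (k - card A)"]) simp
    fix \<epsilon> :: real assume \<epsilon>: "\<epsilon> > 0"
    \<comment> \<open>The first-order remainder of the summand \<open>A\<close>. Each of the
      \<open>2 ^ k\<close> summands gets the share \<open>\<epsilon> / 2 ^ k\<close> of the
      error.\<close>
    let ?r = "\<lambda>h hs A. ?t (\<lambda>t. x t + h t) hs A - ?t x hs A - (?d x (nths hs A @ [h]) * ?e x (nths hs (- A))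
      + ?d x (nths hs A) * ?e x (nths hs (- A) @ [h]))"
    have summand: "\<exists>\<delta>>0. \<forall>h\<in>X. nrm h < \<delta> \<longrightarrow> (\<forall>hs\<in>lists X. length hs = k \<longrightarrow>
        \<bar>?r h hs A\<bar> \<le> \<epsilon> / 2 ^ k * nrm h * ?p hs)" if A: "A \<in> Pow {..<k}" for A
    proof -
      let ?j = "card A" and ?l = "k - card A"
      \<comment> \<open>The three terms are the coefficients in the bounds of
        \<open>(dP - P') * Q\<close>, \<open>P * (dQ - Q')\<close> and \<open>dP * dQ\<close> below;
        the final 1 ensures positivity.\<close>
      define C where "C = N ?l + M ?j + (M (Suc ?j) + 1) * (N (Suc ?l) + 1) + 1"
      have C: "C > 0" unfolding C_def using M(1) N(1) by (intro add_nonneg_pos add_nonneg_nonneg mult_nonneg_nonneg) auto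
      define e where "e = min 1 (\<epsilon> / 2 ^ k / C)"
      have e: "0 < e" "e \<le> 1" "e * C \<le> \<epsilon> / 2 ^ k"
        unfolding e_def using \<epsilon> C by (auto simp: min_def field_simps)
      obtain \<delta>1 where \<delta>1: "\<delta>1 > 0" "\<forall>h\<in>X. nrm h < \<delta>1 \<longrightarrow> (\<forall>hs\<in>lists X. length hs = ?j \<longrightarrow>
         \<bar>D ?j (\<lambda>t. x t + h t) hs - D ?j x hs - D (Suc ?j) x (hs @ [h])\<bar> \<le> e * nrm h * ?p hs)"
        using is_derivs_frechet[OF D x e(1), of ?j] by (elim exE conjE)
      obtain \<delta>2 where \<delta>2: "\<delta>2 > 0" "\<forall>h\<in>X. nrm h < \<delta>2 \<longrightarrow> (\<forall>hs\<in>lists X. length hs = ?l \<longrightarrow>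
         \<bar>E ?l (\<lambda>t. x t + h t) hs - E ?l x hs - E (Suc ?l) x (hs @ [h])\<bar> \<le> e * nrm h * ?p hs)"
        using is_derivs_frechet[OF E x e(1), of ?l] by (elim exE conjE)
      have "\<bar>?r h hs A\<bar> \<le> \<epsilon> / 2 ^ k * nrm h * ?p hs"
        if h: "h \<in> X" "nrm h < min e (min \<delta>1 \<delta>2)" and hs: "hs \<in> lists X" "length hs = k" for h hs
      proof -
        let ?x' = "\<lambda>t. x t + h t"
        define n where "n = nrm h"
        define p q where "p = ?p (nths hs A)" and "q = ?p (nths hs (- A))"
        note l = lists_nths[OF hs(1), of A] lists_nths[OF hs(1), of "- A"]
        have len': "length (nths hs A) = ?j" "length (nths hs (- A)) = ?l"
          using len[of A hs] A hs(2) by auto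
        have nn: "n \<ge> 0" "p \<ge> 0" "q \<ge> 0" "n \<le> e"
          unfolding n_def p_def q_def using nrm_nonneg[OF h(1)] prod_nrm_nonneg[OF l(1)] prod_nrm_nonneg[OF l(2)] h(2)
          by auto
        define P P' dP where "P = ?d x (nths hs A)" and "P' = ?d x (nths hs A @ [h])"
          and "dP = ?d ?x' (nths hs A) - ?d x (nths hs A)"
        define Q Q' dQ where "Q = ?e x (nths hs (- A))" and "Q' = ?e x (nths hs (- A) @ [h])"
          and "dQ = ?e ?x' (nths hs (- A)) - ?e x (nths hs (- A))"
        have P: "\<bar>P\<bar> \<le> M ?j * p" "\<bar>P'\<bar> \<le> M (Suc ?j) * (p * n)" "\<bar>dP - P'\<bar> \<le> e * n * p"
          using M(2)[OF l(1)] M(2)[of "nths hs A @ [h]"] l(1) h \<delta>1(2)[rule_format, OF h(1) _ l(1) len'(1)]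
          by (simp_all add: P_def P'_def dP_def p_def n_def len')
        have Q: "\<bar>Q\<bar> \<le> N ?l * q" "\<bar>Q'\<bar> \<le> N (Suc ?l) * (q * n)" "\<bar>dQ - Q'\<bar> \<le> e * n * q"
          using N(2)[OF l(2)] N(2)[of "nths hs (- A) @ [h]"] l(2) h \<delta>2(2)[rule_format, OF h(1) _ l(2) len'(2)]
          by (simp_all add: Q_def Q'_def dQ_def q_def n_def len')
        \<comment> \<open>Here \<open>e \<le> 1\<close> bounds the full increments \<open>dP\<close>
          and \<open>dQ\<close> by multiples of \<open>n\<close>. Their product is then quadratic in
          \<open>n\<close>, and \<open>n \<le> e\<close> turns one factor \<open>n\<close> into
          \<open>e\<close>.\<close>
        have "e * n * p \<le> 1 * n * p" "e * n * q \<le> 1 * n * q"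
          using e nn by (intro mult_right_mono; simp)+
        then have "\<bar>dP\<bar> \<le> M (Suc ?j) * (p * n) + 1 * n * p" "\<bar>dQ\<bar> \<le> N (Suc ?l) * (q * n) + 1 * n * q"
          using P(2,3) Q(2,3) by linarith+
        then have "\<bar>dP\<bar> \<le> (M (Suc ?j) + 1) * (n * p)" "\<bar>dQ\<bar> \<le> (N (Suc ?l) + 1) * (n * q)"
          by (simp_all add: algebra_simps)
        then have "\<bar>dP * dQ\<bar> \<le> ((M (Suc ?j) + 1) * (n * p)) * ((N (Suc ?l) + 1) * (n * q))"
          unfolding abs_mult using nn M(1)[of "Suc ?j"] by (intro mult_mono) auto
        also have "\<dots> = n * ((M (Suc ?j) + 1) * (N (Suc ?l) + 1) * (n * p * q))" by simp
        also have "\<dots> \<le> e * ((M (Suc ?j) + 1) * (N (Suc ?l) + 1) * (n * p * q))"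
          using nn M(1)[of "Suc ?j"] N(1)[of "Suc ?l"] by (intro mult_right_mono mult_nonneg_nonneg) auto
        finally have 3: "\<bar>dP * dQ\<bar> \<le> e * ((M (Suc ?j) + 1) * (N (Suc ?l) + 1) * (n * p * q))" .
        have 1: "\<bar>(dP - P') * Q\<bar> \<le> (e * n * p) * (N ?l * q)"
          unfolding abs_mult using P Q nn e by (intro mult_mono) auto
        have 2: "\<bar>P * (dQ - Q')\<bar> \<le> (M ?j * p) * (e * n * q)"
          unfolding abs_mult using P Q nn e M(1)[of ?j] by (intro mult_mono) auto
        have eq: "?r h hs A = (P + dP) * (Q + dQ) - P * Q - (P' * Q + P * Q')"
          by (simp add: P_def P'_def dP_def Q_def Q'_def dQ_def)
        have "(P + dP) * (Q + dQ) - P * Q - (P' * Q + P * Q') = (dP - P') * Q + P * (dQ - Q') + dP * dQ"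
          by (simp add: algebra_simps)
        then have "\<bar>(P + dP) * (Q + dQ) - P * Q - (P' * Q + P * Q')\<bar> \<le> (e * n * p) * (N ?l * q) + (M ?j * p) * (e * n * q)
            + e * ((M (Suc ?j) + 1) * (N (Suc ?l) + 1) * (n * p * q))"
          using 1 2 3 by linarith
        also have "\<dots> = e * (C - 1) * (n * (p * q))" unfolding C_def by (simp add: algebra_simps)
        also have "\<dots> \<le> \<epsilon> / 2 ^ k * (n * (p * q))"
          using e nn by (intro mult_right_mono) (auto simp: algebra_simps)
        finally show ?thesis
          unfolding eq p_def q_def n_def prod_list_nths_split by (simp add: mult.assoc)
      qed
      then show ?thesis
        using e(1) \<delta>1(1) \<delta>2(1) by (intro exI[of _ "min e (min \<delta>1 \<delta>2)"]) simp
    qed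
    then have "\<forall>A\<in>Pow {..<k}. \<exists>\<delta>. \<delta> > 0 \<and> (\<forall>h\<in>X. nrm h < \<delta> \<longrightarrow> (\<forall>hs\<in>lists X. length hs = k \<longrightarrow>
        \<bar>?r h hs A\<bar> \<le> \<epsilon> / 2 ^ k * nrm h * ?p hs))"
      by simp
    from bchoice[OF this] obtain \<delta> where \<delta>':
      "\<forall>A\<in>Pow {..<k}. \<delta> A > 0 \<and> (\<forall>h\<in>X. nrm h < \<delta> A \<longrightarrow> (\<forall>hs\<in>lists X. length hs = k \<longrightarrow>
        \<bar>?r h hs A\<bar> \<le> \<epsilon> / 2 ^ k * nrm h * ?p hs))"
      by (elim exE)
    note \<delta> = \<delta>'[THEN bspec, THEN conjunct1] \<delta>'[THEN bspec, THEN conjunct2, rule_format]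
    define \<delta>0 where "\<delta>0 = Min (\<delta> ` Pow {..<k})"
    have \<delta>0: "\<delta>0 > 0" "\<And>A. A \<in> Pow {..<k} \<Longrightarrow> \<delta>0 \<le> \<delta> A"
      unfolding \<delta>0_def using \<delta>(1) by (subst Min_gr_iff) auto
    have "\<bar>?L k (\<lambda>t. x t + h t) hs - ?L k x hs - ?L (Suc k) x (hs @ [h])\<bar> \<le> \<epsilon> * nrm h * ?p hs"
      if h: "h \<in> X" "nrm h < \<delta>0" and hs: "hs \<in> lists X" "length hs = k" for h hs
    proof -
      have eq: "?L k (\<lambda>t. x t + h t) hs - ?L k x hs - ?L (Suc k) x (hs @ [h]) = (\<Sum>A\<in>Pow {..<k}. ?r h hs A)"
        unfolding step unfolding hs(2) by (simp only: sum_subtractf)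
      have "\<bar>\<Sum>A\<in>Pow {..<k}. ?r h hs A\<bar> \<le> (\<Sum>A\<in>Pow {..<k}. \<epsilon> / 2 ^ k * nrm h * ?p hs)"
        by (rule order_trans[OF sum_abs sum_mono])
           (rule \<delta>(2)[OF _ h(1) less_le_trans[OF h(2) \<delta>0(2)] hs])
      also have "\<dots> = \<epsilon> * nrm h * ?p hs" by (simp add: card_Pow)
      finally show ?thesis unfolding eq .
    qed
    then show "\<exists>\<delta>>0. \<forall>h\<in>X. nrm h < \<delta> \<longrightarrow> (\<forall>hs\<in>lists X. length hs = k \<longrightarrow>
        \<bar>?L k (\<lambda>t. x t + h t) hs - ?L k x hs - ?L (Suc k) x (hs @ [h])\<bar> \<le> \<epsilon> * nrm h * ?p hs)"
      using \<delta>0(1) by (intro exI[of _ \<delta>0]) simp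
  qed
  then show ?thesis unfolding smooth_on_iff by (rule exI[of _ ?L])
qed

lemma smooth_on_prod:
  assumes "finite I" "\<And>i. i \<in> I \<Longrightarrow> smooth_on X nrm (F i)"
  shows "smooth_on X nrm (\<lambda>x. \<Prod>i\<in>I. F i x)"
  using assms by (induction I) (auto intro: smooth_on_const smooth_on_mult)

end

section \<open>Continuous functions on trees\<close>

lemma openin_tree_cone: "openin (tree_topology le) {s. le s t}"
  unfolding tree_topology_def by (rule topology_generated_by_Basis) blast

lemma is_tree_order:
  assumes "is_tree le"
  shows is_tree_refl: "le x x"
    and is_tree_antisym: "le x y \<Longrightarrow> le y x \<Longrightarrow> x = y"
    and is_tree_trans: "le x y \<Longrightarrow> le y z \<Longrightarrow> le x z"
  using assms unfolding is_tree_def by (elim conjE; iprover)+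

lemma is_tree_least:
  assumes "is_tree le" "S \<subseteq> {s. le s t}" "S \<noteq> {}"
  shows "\<exists>m\<in>S. \<forall>s\<in>S. le m s"
  using assms unfolding is_tree_def by (elim conjE; iprover)

lemma topspace_tree_topology:
  assumes "is_tree le"
  shows "topspace (tree_topology le) = UNIV"
  using is_tree_refl[OF assms] unfolding tree_topology_def topology_generated_by_topspace by blast

text \<open>\<open>V\<close> plays the role of an interval ending at \<open>\<tau>\<close>. For a
  subbasic set containing \<open>\<tau>\<close>, intersect with the cone below
  \<open>\<tau>\<close>: a cone containing \<open>\<tau>\<close> contains everything below it, and
  the complement of a cone is closed upwards. The property passes to finite intersections and to
  unions.\<close>

lemma tree_nbhd:
  assumes "is_tree le" "openin (tree_topology le) U" "\<tau> \<in> U"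
  shows "\<exists>V. openin (tree_topology le) V \<and> \<tau> \<in> V \<and> V \<subseteq> U \<and> V \<subseteq> {s. le s \<tau>}
    \<and> (\<forall>a b. a \<in> V \<longrightarrow> le a b \<longrightarrow> le b \<tau> \<longrightarrow> b \<in> V)"
proof -
  let ?S = "{{s. le s t} | t. True} \<union> {- {s. le s t} | t. True}"
  let ?ok = "\<lambda>U V. openin (tree_topology le) V \<and> \<tau> \<in> V \<and> V \<subseteq> U \<and> V \<subseteq> {s. le s \<tau>}
    \<and> (\<forall>a b. a \<in> V \<longrightarrow> le a b \<longrightarrow> le b \<tau> \<longrightarrow> b \<in> V)"
  note refl = is_tree_refl[OF assms(1)] and trans = is_tree_trans[OF assms(1)]
  have "generate_topology_on ?S U"
    using assms(2) unfolding tree_topology_def openin_topology_generated_by_iff .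
  then show "\<exists>V. ?ok U V" using assms(3)
  proof (induction rule: generate_topology_on.induct)
    case Empty
    then show ?case by simp
  next
    case (Int a b)
    then have \<tau>: "\<tau> \<in> a" "\<tau> \<in> b" by auto
    obtain V where V: "?ok a V" using Int.IH(1)[OF \<tau>(1)] by (rule exE)
    obtain W where W: "?ok b W" using Int.IH(2)[OF \<tau>(2)] by (rule exE)
    from V W have "?ok (a \<inter> b) (V \<inter> W)" by (auto simp: openin_Int)
    then show ?case by (rule exI)
  next
    case (UN K)
    then obtain k where k: "k \<in> K" "\<tau> \<in> k" by auto
    obtain V where "?ok k V" using UN.IH[OF k] by (rule exE)
    with k(1) have "?ok (\<Union>K) V" by auto
    then show ?case by (rule exI)
  next
    case (Basis s)
    have "openin (tree_topology le) (- {s. le s t})" for t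
      unfolding tree_topology_def by (rule topology_generated_by_Basis) blast
    then have "openin (tree_topology le) s" using Basis openin_tree_cone[of le] by auto
    moreover have "b \<in> s" if "a \<in> s" "le a b" "le b \<tau>" for a b
      using Basis that trans[of a b] trans[of b \<tau>] by auto
    ultimately have "?ok s (s \<inter> {s. le s \<tau>})"
      using Basis refl openin_tree_cone[of le] by auto
    then show ?case by (rule exI)
  qed
qed

definition imm_succ :: "('a \<Rightarrow> 'a \<Rightarrow> bool) \<Rightarrow> 'a \<Rightarrow> 'a set" where
  "imm_succ le t = {s. le t s \<and> s \<noteq> t \<and> (\<forall>u. le t u \<and> u \<noteq> t \<and> le u s \<longrightarrow> u = s)}"

text \<open>Take the least element of \<open>(t, v]\<close>, by well-ordering of the cone below
  \<open>v\<close>.\<close>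

lemma imm_succ_below:
  assumes "is_tree le" "le t v" "t \<noteq> v"
  obtains s where "s \<in> imm_succ le t" "le s v"
proof -
  have "{u. le u v \<and> le t u \<and> u \<noteq> t} \<subseteq> {s. le s v}" "{u. le u v \<and> le t u \<and> u \<noteq> t} \<noteq> {}"
    using assms is_tree_refl[OF assms(1)] by auto
  then obtain m where m: "le m v" "le t m" "m \<noteq> t"
      and min: "\<And>u. le u v \<Longrightarrow> le t u \<Longrightarrow> u \<noteq> t \<Longrightarrow> le m u"
    using is_tree_least[OF assms(1), of "{u. le u v \<and> le t u \<and> u \<noteq> t}" v] by auto
  have "u = m" if "le t u" "u \<noteq> t" "le u m" for u
    using min[of u] that is_tree_trans[OF assms(1) that(3) m(1)] is_tree_antisym[OF assms(1)] by blast
  then have "m \<in> imm_succ le t"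
    unfolding imm_succ_def using m by blast
  with m that show thesis by blast
qed

text \<open>Elements below \<open>v\<close> are comparable, as a two-element set has a least
  element, and comparable immediate successors of \<open>t\<close> coincide.\<close>

lemma imm_succ_unique_below:
  assumes "is_tree le" "s \<in> imm_succ le t" "s' \<in> imm_succ le t" "le s v" "le s' v"
  shows "s = s'"
proof -
  have "{s, s'} \<subseteq> {u. le u v}" "{s, s'} \<noteq> {}" using assms by auto
  then obtain m where "m \<in> {s, s'}" "\<forall>u\<in>{s, s'}. le m u"
    using is_tree_least[OF assms(1)] by meson
  then show ?thesis using assms unfolding imm_succ_def by blast
qed

section \<open>Finiteness from compact level sets\<close>

lemma C0_continuous: "f \<in> C0 le \<Longrightarrow> continuous_map (tree_topology le) euclideanreal f"
  by (simp add: C0_def)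

lemma C0_compactin: "f \<in> C0 le \<Longrightarrow> \<epsilon> > 0 \<Longrightarrow> compactin (tree_topology le) {t. \<bar>f t\<bar> \<ge> \<epsilon>}"
  by (simp add: C0_def)

text \<open>Finitely many cones cover the compact level set, and each cone contains at most one
  immediate successor of \<open>t\<close>.\<close>

lemma finite_imm_succ_ge:
  assumes "is_tree le" "f \<in> C0 le" "\<epsilon> > 0"
  shows "finite {s \<in> imm_succ le t. \<bar>f s\<bar> \<ge> \<epsilon>}"
proof -
  let ?K = "{t. \<bar>f t\<bar> \<ge> \<epsilon>}"
  have "\<exists>\<F>. finite \<F> \<and> \<F> \<subseteq> range (\<lambda>t. {s. le s t}) \<and> ?K \<subseteq> \<Union>\<F>"
  proof (rule compactinD[OF C0_compactin[OF assms(2,3)]])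
    show "openin (tree_topology le) U" if "U \<in> range (\<lambda>t. {s. le s t})" for U
      using that openin_tree_cone[of le] by auto
    show "?K \<subseteq> \<Union> (range (\<lambda>t. {s. le s t}))"
      using is_tree_refl[OF assms(1)] by blast
  qed
  then obtain \<F> where \<F>: "finite \<F>" "\<F> \<subseteq> range (\<lambda>t. {s. le s t})" "?K \<subseteq> \<Union>\<F>"
    by (elim exE conjE)
  have "finite (C \<inter> imm_succ le t)" if CF: "C \<in> \<F>" for C
  proof -
    obtain v where C: "C = {s. le s v}" using \<F>(2)[THEN subsetD, OF CF] by auto
    show ?thesis
    proof (cases "C \<inter> imm_succ le t = {}")
      case False
      then obtain s where "s \<in> imm_succ le t" "le s v" using C by auto
      then have "C \<inter> imm_succ le t \<subseteq> {s}"
        using imm_succ_unique_below[OF assms(1)] C by auto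
      then show ?thesis by (rule finite_subset) simp
    qed simp
  qed
  then have "finite (\<Union>C\<in>\<F>. C \<inter> imm_succ le t)" using \<F>(1) by (rule finite_UN_I[rotated])
  then show ?thesis by (rule rev_finite_subset) (use \<F>(3) in auto)
qed

lemma finite_gap_points:
  assumes "is_tree le" "f \<in> C0 le" "\<epsilon> > 0" "\<delta> > 0"
  shows "finite {t. \<bar>f t\<bar> \<ge> \<epsilon> \<and> (\<forall>s\<in>imm_succ le t. \<bar>f s\<bar> \<le> \<bar>f t\<bar> - \<delta>)}" (is "finite ?S")
proof (rule ccontr)
  assume "infinite ?S"
  moreover have "?S \<subseteq> {t. \<bar>f t\<bar> \<ge> \<epsilon>}" by auto
  ultimately obtain \<tau> where \<tau>: "\<tau> \<in> tree_topology le derived_set_of ?S"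
    using compactin_imp_Bolzano_Weierstrass[OF C0_compactin[OF assms(2,3)]] by blast
  \<comment> \<open>Two points of \<open>?U\<close> have values less than \<open>\<delta>\<close>
    apart, so a gap point and its immediate successor cannot both lie in it.\<close>
  let ?U = "{u \<in> topspace (tree_topology le). f u \<in> ball (f \<tau>) (\<delta> / 2)}"
  have "openin (tree_topology le) ?U"
    by (rule openin_continuous_map_preimage[OF C0_continuous[OF assms(2)]]) simp
  moreover have "\<tau> \<in> ?U" using assms topspace_tree_topology[OF assms(1)] by simp
  ultimately have "\<exists>V. openin (tree_topology le) V \<and> \<tau> \<in> V \<and> V \<subseteq> ?U \<and> V \<subseteq> {s. le s \<tau>}
    \<and> (\<forall>a b. a \<in> V \<longrightarrow> le a b \<longrightarrow> le b \<tau> \<longrightarrow> b \<in> V)"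
    by (rule tree_nbhd[OF assms(1)])
  then obtain V where V: "openin (tree_topology le) V" "\<tau> \<in> V" "V \<subseteq> ?U" "V \<subseteq> {s. le s \<tau>}"
    "\<forall>a b. a \<in> V \<longrightarrow> le a b \<longrightarrow> le b \<tau> \<longrightarrow> b \<in> V"
    by (elim exE conjE)
  then obtain t where t: "t \<noteq> \<tau>" "t \<in> ?S" "t \<in> V"
    using \<tau> unfolding in_derived_set_of by blast
  then obtain s where s: "s \<in> imm_succ le t" "le s \<tau>"
    using imm_succ_below[OF assms(1) _ t(1)] V(4) by blast
  \<comment> \<open>\<open>s\<close> lies between \<open>t\<close> and \<open>\<tau>\<close>, and
    \<open>V\<close> is closed upwards below \<open>\<tau>\<close>.\<close>
  then have "s \<in> V" using V(5)[rule_format, OF t(3), of s] s(2) unfolding imm_succ_def by simp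
  then have "\<bar>f s - f \<tau>\<bar> < \<delta> / 2" "\<bar>f t - f \<tau>\<bar> < \<delta> / 2"
    using V(3) t(3) by (auto simp: dist_real_def abs_minus_commute)
  moreover have "\<bar>f s\<bar> \<le> \<bar>f t\<bar> - \<delta>" using t(2) s(1) by simp
  ultimately show False by linarith
qed

section \<open>Maxima, maximal elements and peaks\<close>

lemma C0_attains:
  assumes "is_tree le" "f \<in> C0 le" "f t0 \<noteq> 0"
  obtains t where "\<And>u. \<bar>f u\<bar> \<le> \<bar>f t\<bar>"
proof -
  \<comment> \<open>A compact level set containing \<open>t0\<close>; outside it
    \<open>\<bar>f\<bar>\<close> is smaller than at \<open>t0\<close>.\<close>
  let ?K = "{t. \<bar>f t\<bar> \<ge> \<bar>f t0\<bar>}"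
  have "continuous_map (tree_topology le) euclideanreal (\<lambda>t. \<bar>f t\<bar>)"
    by (intro continuous_map_real_abs C0_continuous[OF assms(2)])
  then have "compactin euclideanreal ((\<lambda>t. \<bar>f t\<bar>) ` ?K)"
    by (rule image_compactin[rotated]) (use C0_compactin[OF assms(2)] assms(3) in simp)
  then have "compact ((\<lambda>t. \<bar>f t\<bar>) ` ?K)" by simp
  moreover have "(\<lambda>t. \<bar>f t\<bar>) ` ?K \<noteq> {}" by auto
  ultimately have "\<exists>m\<in>(\<lambda>t. \<bar>f t\<bar>) ` ?K. \<forall>y\<in>(\<lambda>t. \<bar>f t\<bar>) ` ?K. y \<le> m"
    by (rule compact_attains_sup)
  then obtain t where t: "t \<in> ?K" "\<forall>u\<in>?K. \<bar>f u\<bar> \<le> \<bar>f t\<bar>" by auto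
  have "\<bar>f u\<bar> \<le> \<bar>f t\<bar>" for u
    using t by (cases "u \<in> ?K") auto
  then show thesis using that by blast
qed

lemma C0_bdd_above:
  assumes "is_tree le" "f \<in> C0 le"
  shows "bdd_above (range (\<lambda>t. \<bar>f t\<bar>))"
proof (cases "\<forall>t. f t = 0")
  case True
  then show ?thesis by simp
next
  case False
  then obtain t where "\<And>u. \<bar>f u\<bar> \<le> \<bar>f t\<bar>" using C0_attains[OF assms] by blast
  then show ?thesis unfolding bdd_above_def by auto
qed

text \<open>The complement is closed downwards, hence a union of open cones.\<close>

lemma closedin_tree_above:
  assumes "is_tree le"
  shows "closedin (tree_topology le) {u. le t u}"
proof -
  have "- {u. le t u} = (\<Union>u\<in>- {u. le t u}. {s. le s u})"
    using is_tree_refl[OF assms] is_tree_trans[OF assms] by blast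
  moreover have "openin (tree_topology le) (\<Union>u\<in>- {u. le t u}. {s. le s u})"
    using openin_tree_cone[of le] by (intro openin_Union) auto
  ultimately have "openin (tree_topology le) (- {u. le t u})" by simp
  then show ?thesis
    by (simp add: closedin_def topspace_tree_topology[OF assms] Compl_eq_Diff_UNIV)
qed

text \<open>Zorn's lemma. The sets above the members of a chain are closed, and finitely many of
  them meet \<open>M\<close> because a finite nonempty subchain has a greatest element. By
  compactness they all meet in \<open>M\<close>, which gives an upper bound of the chain inside
  \<open>M\<close>.\<close>

lemma compactin_tree_maximal:
  assumes "is_tree le" "compactin (tree_topology le) M" "M \<noteq> {}"
  obtains t where "t \<in> M" "\<And>u. u \<in> M \<Longrightarrow> le t u \<Longrightarrow> u = t"
proof -
  note refl = is_tree_refl[OF assms(1)] and trans = is_tree_trans[OF assms(1)]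
    and antisym = is_tree_antisym[OF assms(1)]
  have "\<exists>t\<in>M. \<forall>u\<in>M. le t u \<longrightarrow> u = t"
  proof (rule predicate_Zorn)
    show "partial_order_on M (relation_of le M)"
      by (rule partial_order_on_relation_ofI) (use refl trans antisym in blast)+
    fix C assume "C \<in> Chains (relation_of le M)"
    then have CM: "C \<subseteq> M" and C: "\<And>a b. a \<in> C \<Longrightarrow> b \<in> C \<Longrightarrow> le a b \<or> le b a"
      unfolding Chains_def relation_of_def by blast+
    let ?\<U> = "(\<lambda>c. {u. le c u}) ` C"
    have fin: "\<exists>u\<in>M. \<forall>c\<in>B. le c u" if "finite B" "B \<subseteq> C" for B
    proof (cases "B = {}")
      case True
      then show ?thesis using assms(3) by auto
    next
      case False
      from that(1) False that(2) have "\<exists>u\<in>B. \<forall>c\<in>B. le c u"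
      proof (induction B rule: finite_ne_induct)
        case (singleton x)
        then show ?case using refl by blast
      next
        case (insert x B)
        then obtain u where u: "u \<in> B" "\<forall>c\<in>B. le c u" by auto
        then consider "le x u" | "le u x" using C[of x u] insert.prems by auto
        then show ?case
        proof cases
          case 1
          then show ?thesis using u by auto
        next
          case 2
          then have "\<forall>c\<in>insert x B. le c x" using u(2) refl trans[OF _ 2] by auto
          then show ?thesis by auto
        qed
      qed
      then show ?thesis using that CM by auto
    qed
    have "M \<inter> \<Inter>?\<U> \<noteq> {}"
    proof -
      have "M \<inter> \<Inter>\<F> \<noteq> {}" if F: "finite \<F>" "\<F> \<subseteq> ?\<U>" for \<F>
      proof -
        obtain B where "B \<subseteq> C" "finite B" "\<F> = (\<lambda>c. {u. le c u}) ` B"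
          using finite_subset_image[OF F] by auto
        then show ?thesis using fin[of B] by auto
      qed
      moreover have "\<forall>U\<in>?\<U>. closedin (tree_topology le) U"
        using closedin_tree_above[OF assms(1)] by auto
      ultimately show ?thesis
        using assms(2) unfolding compactin_fip by metis
    qed
    then show "\<exists>u\<in>M. \<forall>a\<in>C. le a u" by auto
  qed
  then show thesis using that by auto
qed

lemma C0_maximal_peak:
  assumes "is_tree le" "f \<in> C0 le" "f t0 \<noteq> 0"
  obtains t \<delta> where "\<And>u. \<bar>f u\<bar> \<le> \<bar>f t\<bar>" "\<delta> > 0"
    "\<And>s. s \<in> imm_succ le t \<Longrightarrow> \<bar>f s\<bar> \<le> \<bar>f t\<bar> - \<delta>"
proof -
  obtain v where v: "\<And>u. \<bar>f u\<bar> \<le> \<bar>f v\<bar>" using C0_attains[OF assms] by blast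
  define m where "m = \<bar>f v\<bar>"
  have m: "m > 0" using v[of t0] assms(3) unfolding m_def by linarith
  have "v \<in> {t. \<bar>f t\<bar> \<ge> m}" by (simp add: m_def)
  then have "{t. \<bar>f t\<bar> \<ge> m} \<noteq> {}" by auto
  from compactin_tree_maximal[OF assms(1) C0_compactin[OF assms(2) m] this]
  obtain t where t: "\<bar>f t\<bar> \<ge> m" "\<And>u. \<bar>f u\<bar> \<ge> m \<Longrightarrow> le t u \<Longrightarrow> u = t"
    by (metis mem_Collect_eq)
  have ft: "\<bar>f t\<bar> = m" using t(1) v[of t] unfolding m_def by linarith
  let ?A = "{s \<in> imm_succ le t. \<bar>f s\<bar> \<ge> m / 2}"
  have fin: "finite ?A" by (rule finite_imm_succ_ge[OF assms(1,2)]) (use m in simp)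
  have lt: "\<bar>f s\<bar> < m" if "s \<in> imm_succ le t" for s
    using t(2)[of s] that unfolding imm_succ_def by (cases "m \<le> \<bar>f s\<bar>") auto
  \<comment> \<open>The finitely many successors with values at least \<open>m / 2\<close> have
    individual positive gaps; the entry \<open>m / 2\<close> serves all others.\<close>
  define \<delta> where "\<delta> = Min (insert (m / 2) ((\<lambda>s. m - \<bar>f s\<bar>) ` ?A))"
  show thesis
  proof
    show "\<bar>f u\<bar> \<le> \<bar>f t\<bar>" for u using v[of u] ft unfolding m_def by simp
    show "\<delta> > 0" unfolding \<delta>_def using fin m lt by (subst Min_gr_iff) auto
    show "\<bar>f s\<bar> \<le> \<bar>f t\<bar> - \<delta>" if "s \<in> imm_succ le t" for s
    proof (cases "\<bar>f s\<bar> \<ge> m / 2")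
      case True
      then have "\<delta> \<le> m - \<bar>f s\<bar>" unfolding \<delta>_def using fin that by (intro Min_le) auto
      then show ?thesis using ft by linarith
    next
      case False
      moreover have "\<delta> \<le> m / 2" unfolding \<delta>_def using fin by (intro Min_le) auto
      ultimately show ?thesis using ft by linarith
    qed
  qed
qed

section \<open>Linear structure and supremum norm of \<open>C0\<close>\<close>

lemma C0_add:
  assumes "is_tree le" "f \<in> C0 le" "g \<in> C0 le"
  shows "(\<lambda>t. f t + g t) \<in> C0 le"
proof -
  have cont: "continuous_map (tree_topology le) euclideanreal (\<lambda>t. f t + g t)"
    by (intro continuous_map_add C0_continuous assms)
  have "compactin (tree_topology le) {t. \<epsilon> \<le> \<bar>f t + g t\<bar>}" if "\<epsilon> > 0" for \<epsilon>
  proof (rule closed_compactin)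
    show "compactin (tree_topology le) ({t. \<epsilon> / 2 \<le> \<bar>f t\<bar>} \<union> {t. \<epsilon> / 2 \<le> \<bar>g t\<bar>})"
      using that by (intro compactin_Un C0_compactin assms) auto
    show "{t. \<epsilon> \<le> \<bar>f t + g t\<bar>} \<subseteq> {t. \<epsilon> / 2 \<le> \<bar>f t\<bar>} \<union> {t. \<epsilon> / 2 \<le> \<bar>g t\<bar>}" by auto
    show "closedin (tree_topology le) {t. \<epsilon> \<le> \<bar>f t + g t\<bar>}"
      using closedin_continuous_map_preimage[OF continuous_map_real_abs[OF cont], of "{\<epsilon>..}"]
      by (simp add: topspace_tree_topology[OF assms(1)])
  qed
  with cont show ?thesis by (simp add: C0_def)
qed

lemma C0_cmult:
  assumes "is_tree le" "f \<in> C0 le"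
  shows "(\<lambda>t. c * f t) \<in> C0 le"
proof -
  have cont: "continuous_map (tree_topology le) euclideanreal (\<lambda>t. c * f t)"
    by (intro continuous_map_real_mult_left C0_continuous assms)
  have "compactin (tree_topology le) {t. \<epsilon> \<le> \<bar>c * f t\<bar>}" if "\<epsilon> > 0" for \<epsilon>
  proof (cases "c = 0")
    case True
    then show ?thesis using that by simp
  next
    case False
    then have "{t. \<epsilon> \<le> \<bar>c * f t\<bar>} = {t. \<epsilon> / \<bar>c\<bar> \<le> \<bar>f t\<bar>}"
      by (auto simp: abs_mult field_simps)
    then show ?thesis using C0_compactin[OF assms(2), of "\<epsilon> / \<bar>c\<bar>"] that False by simp
  qed
  with cont show ?thesis by (simp add: C0_def)
qed

lemma abs_le_supnorm:
  assumes "is_tree le" "f \<in> C0 le"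
  shows "\<bar>f t\<bar> \<le> supnorm f"
  unfolding supnorm_def by (rule cSUP_upper[OF _ C0_bdd_above[OF assms]]) simp

lemma supnorm_le: "(\<And>t. \<bar>f t\<bar> \<le> c) \<Longrightarrow> supnorm f \<le> c"
  unfolding supnorm_def by (rule cSUP_least) auto

section \<open>The bump function\<close>

lemma C0_zero: "(\<lambda>t. 0) \<in> C0 le"
  by (simp add: C0_def)

lemma supnorm_cmult_le:
  assumes "is_tree le" "f \<in> C0 le"
  shows "supnorm (\<lambda>t. c * f t) \<le> \<bar>c\<bar> * supnorm f"
  by (rule supnorm_le) (simp add: abs_mult mult_left_mono abs_le_supnorm[OF assms])

lemma normed_fun_space_C0:
  assumes "is_tree le"
  shows "normed_fun_space (C0 le) supnorm"
proof
  fix f assume f: "f \<in> C0 le"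
  show "(\<lambda>t. c * f t) \<in> C0 le" for c
    by (rule C0_cmult[OF assms f])
  show "\<bar>f t\<bar> \<le> supnorm f" for t
    by (rule abs_le_supnorm[OF assms f])
  show "supnorm (\<lambda>t. c * f t) = \<bar>c\<bar> * supnorm f" for c
  proof (cases "c = 0")
    case True
    then show ?thesis by (simp add: supnorm_def)
  next
    case False
    \<comment> \<open>The reverse inequality is the proved one applied to the factor
      \<open>inverse c\<close>.\<close>
    have "supnorm f = supnorm (\<lambda>t. inverse c * (c * f t))" using False by (simp add: mult.assoc[symmetric])
    also have "\<dots> \<le> \<bar>inverse c\<bar> * supnorm (\<lambda>t. c * f t)"
      by (rule supnorm_cmult_le[OF assms C0_cmult[OF assms f]])
    finally have "\<bar>c\<bar> * supnorm f \<le> supnorm (\<lambda>t. c * f t)"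
      using False by (simp add: field_simps)
    with supnorm_cmult_le[OF assms f, of c] show ?thesis by simp
  qed
  fix g assume g: "g \<in> C0 le"
  show "(\<lambda>t. f t + g t) \<in> C0 le"
    by (rule C0_add[OF assms f g])
  show "supnorm (\<lambda>t. f t + g t) \<le> supnorm f + supnorm g"
    using abs_le_supnorm[OF assms f] abs_le_supnorm[OF assms g]
    by (intro supnorm_le order_trans[OF abs_triangle_ineq] add_mono)
qed

text \<open>\<open>V n\<close> tests whether \<open>\<bar>f t\<bar>\<close> is close to 1, and
  \<open>W n\<close> whether \<open>\<bar>f s\<bar>\<close> is well below 1. The transition zones,
  from \<open>1 - 3 * c n\<close> to \<open>1 - 2 * c n\<close> and from \<open>1 - c n\<close> to
  \<open>1 - c n / 2\<close>, are separated by \<open>c n\<close>; this separation is the jump that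
  limits the active \<open>t\<close>. The bound \<open>1 / 4\<close> makes \<open>W n\<close> equal
  to 1 near 0.\<close>

locale tree_bump =
  fixes le :: "'a \<Rightarrow> 'a \<Rightarrow> bool" and c :: "nat \<Rightarrow> real" and V W :: "nat \<Rightarrow> real \<Rightarrow> real"
  assumes tree: "is_tree le"
    and c_pos: "c n > 0" and c_le: "c n \<le> 1 / 4" and c_antimono: "m \<le> n \<Longrightarrow> c n \<le> c m"
    and c_small: "e > 0 \<Longrightarrow> \<exists>n. c n < e"
    and V_smooth: "smooth_real (V n)" and W_smooth: "smooth_real (W n)"
    and V_one: "\<bar>x\<bar> \<le> 1 - c n \<Longrightarrow> V n x = 1" and V_zero: "\<bar>x\<bar> \<ge> 1 - c n / 2 \<Longrightarrow> V n x = 0"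
    and W_one: "\<bar>x\<bar> \<le> 1 - 3 * c n \<Longrightarrow> W n x = 1" and W_zero: "\<bar>x\<bar> \<ge> 1 - 2 * c n \<Longrightarrow> W n x = 0"
begin

sublocale normed_fun_space "C0 le" supnorm
  by (rule normed_fun_space_C0[OF tree])

text \<open>The infinite products below are products over the factors different from 1. For \<open>f \<in> C0 le\<close> the
  one in \<open>factor\<close> is finite, and so is the one in \<open>bump\<close> as long as \<open>supnorm f < 1\<close>; for other \<open>f\<close>,
  \<open>prod\<close> over an infinite set has the junk value 1.\<close>
definition factor :: "nat \<Rightarrow> 'a \<Rightarrow> ('a \<Rightarrow> real) \<Rightarrow> real" where
  "factor n t f = 1 - (1 - V n (f t)) * (\<Prod>s\<in>{s \<in> imm_succ le t. W n (f s) \<noteq> 1}. W n (f s))"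

definition bump :: "('a \<Rightarrow> real) \<Rightarrow> real" where
  "bump f = (if supnorm f < 1
     then \<Prod>(n, t)\<in>{(n, t). factor n t f \<noteq> 1}. factor n t f else 0)"

section \<open>Local finiteness of the product\<close>

lemma W_one_quarter: "\<bar>x\<bar> \<le> 1 / 4 \<Longrightarrow> W n x = 1"
  using c_le[of n] by (intro W_one) linarith

text \<open>Replaces the index set, which varies with \<open>f\<close>, by a fixed finite set that
  can serve all functions near a given one.\<close>

lemma factor_eq:
  assumes "finite A" "A \<subseteq> imm_succ le t" "\<And>s. s \<in> imm_succ le t - A \<Longrightarrow> W n (f s) = 1"
  shows "factor n t f = 1 - (1 - V n (f t)) * (\<Prod>s\<in>A. W n (f s))"
proof -
  have "(\<Prod>s\<in>{s \<in> imm_succ le t. W n (f s) \<noteq> 1}. W n (f s)) = (\<Prod>s\<in>A. W n (f s))"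
    using assms by (intro prod.mono_neutral_left) auto
  then show ?thesis by (simp add: factor_def)
qed

lemma factor_neq_1:
  assumes f: "f \<in> C0 le" and "factor n t f \<noteq> 1"
  shows "\<bar>f t\<bar> > 1 - c n" "\<And>s. s \<in> imm_succ le t \<Longrightarrow> \<bar>f s\<bar> < 1 - 2 * c n"
proof -
  let ?A = "{s \<in> imm_succ le t. W n (f s) \<noteq> 1}"
  have "finite {s \<in> imm_succ le t. \<bar>f s\<bar> \<ge> 1 / 4}"
    by (rule finite_imm_succ_ge[OF tree f]) simp
  \<comment> \<open>Finiteness matters: only then does a vanishing \<open>W n (f s)\<close> make the
    product 0.\<close>
  then have fin: "finite ?A"
    by (rule rev_finite_subset) (use W_one_quarter in force)
  have "V n (f t) \<noteq> 1" using assms(2) by (auto simp: factor_def)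
  then show "\<bar>f t\<bar> > 1 - c n" using V_one[of "f t" n] by fastforce
  fix s assume s: "s \<in> imm_succ le t"
  have "prod (\<lambda>s. W n (f s)) ?A \<noteq> 0" using assms(2) by (auto simp: factor_def)
  then have "W n (f s) \<noteq> 0" using fin s by auto
  then show "\<bar>f s\<bar> < 1 - 2 * c n" using W_zero[of n "f s"] by fastforce
qed

lemma locally_finite_factors:
  assumes f: "f \<in> C0 le" "supnorm f < 1"
  shows "\<exists>\<rho> I. 0 < \<rho> \<and> \<rho> \<le> 1 / 8 \<and> finite I \<and> (\<forall>h\<in>C0 le. supnorm h < \<rho> \<longrightarrow>
    supnorm (\<lambda>t. f t + h t) < 1 \<and> (\<forall>n t. factor n t (\<lambda>t. f t + h t) \<noteq> 1 \<longrightarrow> (n, t) \<in> I))"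
proof -
  \<comment> \<open>Perturbations of size below \<open>?e\<close> keep the norm below
    \<open>1 - ?e\<close>. For \<open>n \<ge> N\<close> no value can then exceed
    \<open>1 - c n\<close>, so all these factors are 1.\<close>
  let ?e = "(1 - supnorm f) / 2"
  obtain N where N: "c N < ?e" using c_small[of ?e] f(2) by auto
  \<comment> \<open>An active factor of the perturbed function forces a jump larger than
    \<open>c n \<ge> c N\<close>. Two errors of at most \<open>c N / 4\<close> leave a jump of at
    least \<open>c N / 2\<close> for \<open>f\<close>, and \<open>\<bar>f t\<bar>\<close> stays
    above \<open>1 / 2\<close>.\<close>
  let ?T = "{t. \<bar>f t\<bar> \<ge> 1 / 2 \<and> (\<forall>s\<in>imm_succ le t. \<bar>f s\<bar> \<le> \<bar>f t\<bar> - c N / 2)}"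
  show ?thesis
  proof (intro exI[of _ "min ?e (c N / 4)"] exI[of _ "{..<N} \<times> ?T"] conjI ballI allI impI)
    show "0 < min ?e (c N / 4)" using f(2) c_pos[of N] by simp
    show "min ?e (c N / 4) \<le> 1 / 8" using c_le[of N] by linarith
    show "finite ({..<N} \<times> ?T)"
      using finite_gap_points[OF tree f(1), of "1 / 2" "c N / 2"] c_pos[of N] by simp
    fix h assume h: "h \<in> C0 le" "supnorm h < min ?e (c N / 4)"
    let ?g = "\<lambda>t. f t + h t"
    have g: "supnorm ?g < 1 - ?e"
      using nrm_add[OF f(1) h(1)] h(2) by (simp add: field_simps)
    show "supnorm ?g < 1" by (rule less_trans[OF g]) (use f(2) in simp)
    fix n t assume "factor n t ?g \<noteq> 1"
    from factor_neq_1[OF add_mem[OF f(1) h(1)] this]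
    have t: "\<bar>?g t\<bar> > 1 - c n" and s: "\<And>s. s \<in> imm_succ le t \<Longrightarrow> \<bar>?g s\<bar> < 1 - 2 * c n"
      by auto
    have hu: "\<bar>h u\<bar> < c N / 4" for u
      using abs_le_nrm[OF h(1), of u] h(2) by simp
    have "n < N"
    proof (rule ccontr)
      assume "\<not> n < N"
      then have "c n \<le> c N" by (intro c_antimono) simp
      then show False
        using t abs_le_nrm[OF add_mem[OF f(1) h(1)], of t] g N by linarith
    qed
    then have cn: "c N \<le> c n" by (intro c_antimono) simp
    have "\<bar>f t\<bar> > 1 - c n - c N / 4" using t hu[of t] by linarith
    moreover have "\<bar>f s\<bar> < 1 - 2 * c n + c N / 4" if "s \<in> imm_succ le t" for s
      using s[OF that] hu[of s] by linarith
    ultimately have "t \<in> ?T"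
      using cn c_le[of n] by fastforce
    with \<open>n < N\<close> show "(n, t) \<in> {..<N} \<times> ?T" by simp
  qed
qed

section \<open>Smoothness of the bump inside and outside the unit ball\<close>

lemma smooth_on_one_minus:
  assumes "smooth_on (C0 le) supnorm F"
  shows "smooth_on (C0 le) supnorm (\<lambda>x. 1 - F x)"
  using smooth_on_add[OF smooth_on_const[of 1] smooth_on_mult[OF smooth_on_const[of "-1"] assms]] by simp

text \<open>Near \<open>f\<close> both index sets can be frozen: \<open>I\<close> for the factors
  and \<open>A t\<close> for the successors. The bump then equals a finite polynomial expression in
  smooth functions of point values.\<close>

lemma bump_smooth_inside:
  assumes f: "f \<in> C0 le" "supnorm f < 1"
  shows "\<exists>G \<rho>. \<rho> > 0 \<and> smooth_on (C0 le) supnorm G \<and>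
      (\<forall>h\<in>C0 le. supnorm h < \<rho> \<longrightarrow> bump (\<lambda>t. f t + h t) = G (\<lambda>t. f t + h t))"
proof -
  obtain \<rho> I where \<rho>: "0 < \<rho>" "\<rho> \<le> 1 / 8" and I: "finite I"
    and in1I: "\<forall>h\<in>C0 le. supnorm h < \<rho> \<longrightarrow> supnorm (\<lambda>t. f t + h t) < 1 \<and>
      (\<forall>n t. factor n t (\<lambda>t. f t + h t) \<noteq> 1 \<longrightarrow> (n, t) \<in> I)"
    using locally_finite_factors[OF f] by (elim exE conjE)
  \<comment> \<open>The threshold \<open>1 / 8\<close> together with
    \<open>\<rho> \<le> 1 / 8\<close> keeps the perturbed values outside \<open>A t\<close> below
    \<open>1 / 4\<close>, where \<open>W n\<close> is 1.\<close>
  define A where "A t = {s \<in> imm_succ le t. \<bar>f s\<bar> \<ge> 1 / 8}" for t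
  have A: "finite (A t)" "A t \<subseteq> imm_succ le t" for t
    unfolding A_def by (rule finite_imm_succ_ge[OF tree f(1)]) auto
  define G where "G g = (\<Prod>i\<in>I. 1 - (1 - V (fst i) (g (snd i))) * (\<Prod>s\<in>A (snd i). W (fst i) (g s)))" for g
  have "smooth_on (C0 le) supnorm G"
    unfolding G_def
    by (intro smooth_on_prod I smooth_on_one_minus smooth_on_mult smooth_on_eval V_smooth W_smooth A)
  moreover have "bump (\<lambda>t. f t + h t) = G (\<lambda>t. f t + h t)" if h: "h \<in> C0 le" "supnorm h < \<rho>" for h
  proof -
    let ?g = "\<lambda>t. f t + h t"
    have "W n (?g s) = 1" if "s \<in> imm_succ le t - A t" for n s t
    proof (rule W_one_quarter)
      have "\<bar>f s\<bar> < 1 / 8" using that by (auto simp: A_def)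
      moreover have "\<bar>h s\<bar> < 1 / 8" using abs_le_nrm[OF h(1), of s] h(2) \<rho>(2) by linarith
      ultimately show "\<bar>f s + h s\<bar> \<le> 1 / 4" by linarith
    qed
    then have eq: "factor n t ?g = 1 - (1 - V n (?g t)) * (\<Prod>s\<in>A t. W n (?g s))" for n t
      by (rule factor_eq[OF A])
    have "bump ?g = (\<Prod>(n, t)\<in>{(n, t). factor n t ?g \<noteq> 1}. factor n t ?g)"
      using in1I[rule_format, OF h] by (simp add: bump_def)
    also have "\<dots> = (\<Prod>(n, t)\<in>I. factor n t ?g)"
      by (rule prod.mono_neutral_left[OF I]) (use in1I[rule_format, OF h] in auto)
    also have "\<dots> = G ?g"
      unfolding G_def eq by (simp add: case_prod_beta)
    finally show ?thesis .
  qed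
  ultimately show ?thesis using \<rho>(1) by (intro exI[of _ G] exI[of _ \<rho>]) simp
qed

text \<open>A zero factor annihilates the product because the product is finite, which is local
  finiteness at the perturbation 0.\<close>

lemma bump_eq_0_if_factor_eq_0:
  assumes "f \<in> C0 le" "factor n t f = 0"
  shows "bump f = 0"
proof (cases "supnorm f < 1")
  case True
  have z: "supnorm (\<lambda>t::'a. 0) = 0" by (simp add: supnorm_def)
  obtain \<rho> I where \<rho>: "0 < \<rho>" "finite I" "\<forall>h\<in>C0 le. supnorm h < \<rho> \<longrightarrow> supnorm (\<lambda>t. f t + h t) < 1 \<and>
      (\<forall>n t. factor n t (\<lambda>t. f t + h t) \<noteq> 1 \<longrightarrow> (n, t) \<in> I)"
    using locally_finite_factors[OF assms(1) True] by (elim exE conjE)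
  have I: "\<forall>n t. factor n t f \<noteq> 1 \<longrightarrow> (n, t) \<in> I"
    using bspec[OF \<rho>(3) C0_zero] \<rho>(1) z by simp
  have "finite {(n, t). factor n t f \<noteq> 1}"
    by (rule finite_subset[OF _ \<rho>(2)]) (use I in auto)
  then have "(\<Prod>(n, t)\<in>{(n, t). factor n t f \<noteq> 1}. factor n t f) = 0"
    by (rule prod_zero) (use assms(2) in \<open>auto intro!: exI[of _ n] exI[of _ t]\<close>)
  then show ?thesis by (simp add: bump_def)
qed (simp add: bump_def)

lemma bump_eq_0_outside:
  assumes f: "f \<in> C0 le" "supnorm f \<ge> 1"
  shows "\<exists>\<rho>>0. \<forall>h\<in>C0 le. supnorm h < \<rho> \<longrightarrow> bump (\<lambda>t. f t + h t) = 0"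
proof (cases "supnorm f > 1")
  case True
  have "bump (\<lambda>t. f t + h t) = 0" if h: "h \<in> C0 le" "supnorm h < supnorm f - 1" for h
  proof -
    \<comment> \<open>Triangle inequality for \<open>f = (f + h) + (-1) * h\<close>; the perturbed
      norm stays above 1.\<close>
    have "supnorm f \<le> supnorm (\<lambda>t. f t + h t) + supnorm h"
      using nrm_add[OF add_mem[OF f(1) h(1)] cmult_mem[OF h(1), of "-1"]] nrm_cmult[OF h(1), of "-1"] by simp
    then show ?thesis using h(2) by (simp add: bump_def)
  qed
  then show ?thesis using True by (intro exI[of _ "supnorm f - 1"]) simp
next
  case False
  then have "supnorm f = 1" using f(2) by simp
  moreover have "supnorm f \<le> 0" if "\<And>t. f t = 0" using that by (intro supnorm_le) simp
  ultimately obtain t0 where "f t0 \<noteq> 0" by fastforce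
  then obtain t \<delta> where t: "\<And>u. \<bar>f u\<bar> \<le> \<bar>f t\<bar>" and \<delta>: "\<delta> > 0"
    and s: "\<And>s. s \<in> imm_succ le t \<Longrightarrow> \<bar>f s\<bar> \<le> \<bar>f t\<bar> - \<delta>"
    using C0_maximal_peak[OF tree f(1)] by blast
  have ft: "\<bar>f t\<bar> = 1"
    using supnorm_le[of f, OF t] abs_le_nrm[OF f(1), of t] \<open>supnorm f = 1\<close> by simp
  \<comment> \<open>With \<open>\<delta> > 4 * c n\<close>, a perturbation below
    \<open>c n / 2\<close> keeps the successor values below \<open>1 - 3 * c n\<close> and the value
    at \<open>t\<close> above \<open>1 - c n / 2\<close>, so the peak persists.\<close>
  obtain n where n: "c n < \<delta> / 4" using c_small[of "\<delta> / 4"] \<delta> by auto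
  have "bump (\<lambda>t. f t + h t) = 0" if h: "h \<in> C0 le" "supnorm h < c n / 2" for h
  proof (rule bump_eq_0_if_factor_eq_0[OF add_mem[OF f(1) h(1)]])
    have hu: "\<bar>h u\<bar> < c n / 2" for u
      using abs_le_nrm[OF h(1), of u] h(2) by simp
    have "W n (f s + h s) = 1" if "s \<in> imm_succ le t" for s
      using s[OF that] hu[of s] n ft c_pos[of n] by (intro W_one) linarith
    \<comment> \<open>All \<open>W n\<close> factors are 1, so the empty index set suffices.\<close>
    then have "factor n t (\<lambda>t. f t + h t) = 1 - (1 - V n (f t + h t)) * (\<Prod>s\<in>{}. W n (f s + h s))"
      by (intro factor_eq) auto
    moreover have "V n (f t + h t) = 0"
      using hu[of t] ft by (intro V_zero) linarith
    ultimately show "factor n t (\<lambda>t. f t + h t) = 0" by simp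
  qed
  then show ?thesis using c_pos[of n] by (intro exI[of _ "c n / 2"]) simp
qed

lemma smooth_on_bump: "smooth_on (C0 le) supnorm bump"
proof (rule smooth_on_local)
  fix f assume f: "f \<in> C0 le"
  show "\<exists>G \<rho>. \<rho> > 0 \<and> smooth_on (C0 le) supnorm G \<and>
      (\<forall>h\<in>C0 le. supnorm h < \<rho> \<longrightarrow> bump (\<lambda>t. f t + h t) = G (\<lambda>t. f t + h t))"
  proof (cases "supnorm f < 1")
    case True
    then show ?thesis by (rule bump_smooth_inside[OF f])
  next
    case False
    then obtain \<rho> where "\<rho> > 0" "\<forall>h\<in>C0 le. supnorm h < \<rho> \<longrightarrow> bump (\<lambda>t. f t + h t) = 0"
      using bump_eq_0_outside[OF f] by auto
    then show ?thesis using smooth_on_const[of 0] by (intro exI[of _ "\<lambda>_. 0"] exI[of _ \<rho>]) simp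
  qed
qed

lemma bump_zero: "bump (\<lambda>t. 0) = 1"
proof -
  have "V n 0 = 1" for n using c_le[of n] by (intro V_one) simp
  then have "factor n t (\<lambda>t. 0) = 1" for n t by (simp add: factor_def)
  then show ?thesis by (simp add: bump_def supnorm_def)
qed

end

theorem theorem9p3:
  fixes le :: "'a \<Rightarrow> 'a \<Rightarrow> bool"
  assumes "is_tree le"
  shows "\<exists>F :: ('a \<Rightarrow> real) \<Rightarrow> real.
           smooth_on (C0 le) supnorm F \<and>
           (\<exists>f\<in>C0 le. F f \<noteq> 0) \<and>
           (\<exists>R. \<forall>f\<in>C0 le. F f \<noteq> 0 \<longrightarrow> supnorm f \<le> R)"
proof -
  \<comment> \<open>A decreasing null sequence starting at \<open>1 / 4\<close>, which makes
    \<open>1 - 3 * c n\<close> nonnegative as \<open>smooth_plateau\<close> requires.\<close>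
  define c :: "nat \<Rightarrow> real" where "c n = 1 / (4 * (real n + 1))" for n
  have c: "c n > 0" "c n \<le> 1 / 4" for n by (simp_all add: c_def field_simps)
  have "\<exists>v. smooth_real v \<and> (\<forall>x. \<bar>x\<bar> \<le> 1 - c n \<longrightarrow> v x = 1) \<and> (\<forall>x. \<bar>x\<bar> \<ge> 1 - c n / 2 \<longrightarrow> v x = 0)" for n
    by (rule smooth_plateau) (use c[of n] in linarith)+
  then obtain V where V: "\<forall>n. smooth_real (V n) \<and> (\<forall>x. \<bar>x\<bar> \<le> 1 - c n \<longrightarrow> V n x = 1) \<and> (\<forall>x. \<bar>x\<bar> \<ge> 1 - c n / 2 \<longrightarrow> V n x = 0)"
    by metis
  have "\<exists>w. smooth_real w \<and> (\<forall>x. \<bar>x\<bar> \<le> 1 - 3 * c n \<longrightarrow> w x = 1) \<and> (\<forall>x. \<bar>x\<bar> \<ge> 1 - 2 * c n \<longrightarrow> w x = 0)" for n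
    by (rule smooth_plateau) (use c[of n] in linarith)+
  then obtain W where W: "\<forall>n. smooth_real (W n) \<and> (\<forall>x. \<bar>x\<bar> \<le> 1 - 3 * c n \<longrightarrow> W n x = 1) \<and> (\<forall>x. \<bar>x\<bar> \<ge> 1 - 2 * c n \<longrightarrow> W n x = 0)"
    by metis
  interpret tree_bump le c V W
  proof
    show "c n \<le> c m" if "m \<le> n" for m n
      using that by (simp add: c_def frac_le)
    show "\<exists>n. c n < e" if e: "e > 0" for e
    proof -
      obtain n where "1 / e < real n" using reals_Archimedean2 by blast
      then have "c n < e" using e by (simp add: c_def field_simps add_pos_nonneg)
      then show ?thesis ..
    qed
  qed (use assms c V W in auto)
  show ?thesis
  proof (intro exI[of _ bump] exI[of _ 1] conjI ballI impI)
    show "smooth_on (C0 le) supnorm bump" by (rule smooth_on_bump)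
    show "\<exists>f\<in>C0 le. bump f \<noteq> 0" using bump_zero C0_zero[of le] by (intro bexI[of _ "\<lambda>t. 0"]) auto
    show "supnorm f \<le> 1" if "bump f \<noteq> 0" for f
      using that by (simp add: bump_def split: if_splits)
  qed
qed

end
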